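(* Let $m\ge2$ and let $\lambda=(\lambda_1,\ldots,\lambda_m)$ be a partition of $n$ with at most $m$ parts. Let $\lambda'=(\lambda_1-\lambda_m,\ldots,\lambda_{m-1}-\lambda_m,0)$. Then $\mathrm{Newt}(s_\lambda(x_1,\ldots,x_m))$ is reflexive if and only if $\lambda'$ is one of: $(m,0,\ldots,0)$ (a partition of $m$); $(2,1,\ldots,1,0)$ (a partition of $m$); $(2,\ldots,2,0,\ldots,0)$ with $m/2$ twos and $m/2$ zeros, when $m$ is even; $(2,\ldots,2,1,0,\ldots,0)$ with $(m-1)/2$ twos, one $1$ and $(m-1)/2$ zeros, when $m$ is odd; $(m,\ldots,m,0)$ with $m-1$ entries equal to $m$ (a partition of $m(m-1)$).
   Context: $\mathrm{Newt}(s_\lambda(x_1,\ldots,x_m))$ is the convex hull of the exponent vectors of the Schur polynomial $s_\lambda(x_1,\ldots,x_m)=\sum_T\mathbf{x}^T$ over semistandard Young tableaux of shape $\lambda$ with entries in $\{1,\ldots,m\}$; it equals the convex hull of the $S_m$-orbit of $(\lambda_1,\ldots,\lambda_m)$. The partition $\lambda'$ is said to be obtained from $\lambda$ by reduction by translation. A lattice polytope $\mathcal{P}\subset\mathbb{R}^m$ (possibly not full-dimensional) is reflexive if there is a lattice point $\mathbf{p}$ in its relative interior at lattice distance $1$ from every facet: for each facet $F$ there are no lattice points of $\mathrm{aff}(\mathcal{P})$ strictly between the affine span of $F$ within $\mathrm{aff}(\mathcal{P})$ and its parallel translate through $\mathbf{p}$ (equivalently, after a lattice-preserving identification of $\mathrm{aff}(\mathcal{P})$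 with $\mathbb{R}^k$ and translation by $-\mathbf{p}$, the polar dual is a lattice polytope).
   Formalization: Reflexive polytopes are required here to have positive dimension; otherwise, for λ with all parts equal, the Newton polytope is a single lattice point, vacuously reflexive, although λ' = (0,…,0) is not in the list. *)

theory Defs
  imports "HOL-Analysis.Analysis" "HOL-Library.Poly_Mapping" "HOL-Library.FuncSet"
begin

text \<open>
  Throughout, a finite linearly ordered type \<open>'m\<close> with \<open>CARD('m) = m\<close> plays the role of the
  index set \<open>{1, ..., m}\<close>: it indexes the variables, the coordinates of the ambient space
  \<open>real ^ 'm\<close>, and it is the alphabet of tableau entries.
\<close>

section \<open>Partitions and tableaux\<close>

text \<open>Trailing zero entries are allowed, so a partition with at most \<open>m\<close> parts is a list of
  length \<open>m\<close>.\<close>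

definition is_partition_of :: "nat list \<Rightarrow> nat \<Rightarrow> bool" where
  "is_partition_of lam n \<longleftrightarrow> sorted_wrt (\<ge>) lam \<and> sum_list lam = n"

text \<open>On a partition, \<open>last lam\<close> is the least entry, so the subtraction does not truncate.\<close>

definition reduction_by_translation :: "nat list \<Rightarrow> nat list" where
  "reduction_by_translation lam = map (\<lambda>k. k - last lam) lam"

definition young_diagram :: "nat list \<Rightarrow> (nat \<times> nat) set" where
  "young_diagram lam = {(i, j). i < length lam \<and> j < lam ! i}"

text \<open>English notation: rows weakly increase to the right, columns strictly increase downwards.
  Fillings are extensional, so that each tableau is represented by exactly one function.\<close>

definition ssyt :: "nat list \<Rightarrow> (nat \<times> nat \<Rightarrow> 'a::linorder) set" where
  "ssyt lam = {T \<in> young_diagram lam \<rightarrow>\<^sub>E UNIV.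
     (\<forall>i j j'. j < j' \<and> (i, j) \<in> young_diagram lam \<and> (i, j') \<in> young_diagram lam
        \<longrightarrow> T (i, j) \<le> T (i, j')) \<and>
     (\<forall>i i' j. i < i' \<and> (i, j) \<in> young_diagram lam \<and> (i', j) \<in> young_diagram lam
        \<longrightarrow> T (i, j) < T (i', j))}"

lemma finite_young_diagram: "finite (young_diagram lam)"
proof -
  have "young_diagram lam = (SIGMA i:{..<length lam}. {..<lam ! i})"
    by (auto simp: young_diagram_def)
  then show ?thesis by simp
qed

lemma finite_ssyt: "finite (ssyt lam :: (nat \<times> nat \<Rightarrow> 'a::{finite,linorder}) set)"
  by (rule finite_subset[OF _ finite_PiE[OF finite_young_diagram[of lam]]])
     (auto simp: ssyt_def)

section \<open>Schur polynomials and Newton polytopes\<close>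

text \<open>A polynomial in variables indexed by \<open>'v\<close> with coefficients in \<open>'r\<close> is a finitely supported
  map from exponent vectors (monomials) to coefficients; its product is convolution.\<close>

definition var :: "'v \<Rightarrow> ('v \<Rightarrow>\<^sub>0 nat) \<Rightarrow>\<^sub>0 int" where
  "var v = Poly_Mapping.single (Poly_Mapping.single v 1) 1"

definition schur_polynomial :: "nat list \<Rightarrow> ('v::{finite,linorder} \<Rightarrow>\<^sub>0 nat) \<Rightarrow>\<^sub>0 int" where
  "schur_polynomial lam = (\<Sum>T\<in>ssyt lam. \<Prod>c\<in>young_diagram lam. var (T c))"

definition exponent_vector :: "('v::finite \<Rightarrow>\<^sub>0 nat) \<Rightarrow> real ^ 'v" where
  "exponent_vector e = (\<chi> v. real (Poly_Mapping.lookup e v))"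

definition Newt :: "(('v::finite \<Rightarrow>\<^sub>0 nat) \<Rightarrow>\<^sub>0 'r::zero) \<Rightarrow> (real ^ 'v) set" where
  "Newt f = convex hull (exponent_vector ` Poly_Mapping.keys f)"

section \<open>Reflexive lattice polytopes\<close>

definition lattice_point :: "real ^ 'v \<Rightarrow> bool" where
  "lattice_point x \<longleftrightarrow> (\<forall>v. x $ v \<in> \<int>)"

definition lattice_polytope :: "(real ^ 'v::finite) set \<Rightarrow> bool" where
  "lattice_polytope P \<longleftrightarrow>
     (\<exists>V. finite V \<and> (\<forall>x\<in>V. lattice_point x) \<and> P = convex hull V)"

definition parallel_through :: "'a::real_vector \<Rightarrow> 'a set \<Rightarrow> 'a set" where
  "parallel_through p H = {p + (x - y) | x y. x \<in> H \<and> y \<in> H}"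

definition strictly_between :: "'a::real_vector set \<Rightarrow> 'a set \<Rightarrow> 'a set" where
  "strictly_between H K = (\<Union>h\<in>H. \<Union>k\<in>K. open_segment h k)"

text \<open>If \<open>F\<close> is a facet of \<open>P\<close> and \<open>p\<close> lies in the relative interior of \<open>P\<close>, then \<open>affine hull F\<close> is
  a hyperplane of \<open>affine hull P\<close> not containing \<open>p\<close>, and the union of open segments above is
  exactly the open slab of \<open>affine hull P\<close> between it and its parallel through \<open>p\<close>.\<close>

definition lattice_distance_one :: "real ^ 'v::finite \<Rightarrow> (real ^ 'v) set \<Rightarrow> bool" where
  "lattice_distance_one p F \<longleftrightarrow>
     (\<forall>q \<in> strictly_between (affine hull F) (parallel_through p (affine hull F)).
        \<not> lattice_point q)"

text \<open>Reflexive polytopes have positive dimension by convention. A single lattice point has no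
  (nonempty) facet, so without this clause it would be reflexive vacuously. Otherwise \<open>P\<close> need not
  be full-dimensional.\<close>

definition reflexive :: "(real ^ 'v::finite) set \<Rightarrow> bool" where
  "reflexive P \<longleftrightarrow>
     lattice_polytope P \<and> aff_dim P > 0 \<and>
     (\<exists>p. lattice_point p \<and> p \<in> rel_interior P \<and>
        (\<forall>F. F facet_of P \<longrightarrow> lattice_distance_one p F))"

end

theory Submission
  imports Defs
begin

text \<open>
  By Rado's theorem the Newton polytope is cut out of the hyperplane \<open>\<Sum> x\<^sub>i = n\<close> by the inequalities
  \<open>\<Sum>\<^sub>i\<^sub>\<in>\<^sub>S x\<^sub>i \<le> \<lambda>\<^sub>1 + \<dots> + \<lambda>\<^sub>k\<close> with \<open>k = card S\<close>. For nonconstant \<open>\<lambda>\<close>, such an inequality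
  defines a facet if and only if \<open>k = 1\<close> or \<open>\<lambda>\<^sub>k < \<lambda>\<^sub>1\<close>, and \<open>k = m - 1\<close> or \<open>\<lambda>\<^sub>m < \<lambda>\<^sub>k\<^sub>+\<^sub>1\<close>. A point at
  distance \<open>1\<close> from all facets has the same sum over every \<open>S\<close> of a given facet-defining size, so it is
  \<open>(c, \<dots>, c)\<close>; reflexivity thus means \<open>n = m c\<close> and \<open>\<lambda>\<^sub>1 + \<dots> + \<lambda>\<^sub>k = k c + 1\<close> for all facet-defining
  \<open>k\<close>. If both \<open>k = 1\<close> and \<open>k = m - 1\<close> occur, the parts of \<open>\<lambda>'\<close> are \<open>0\<close>, \<open>1\<close>, \<open>2\<close>, with as many
  \<open>2\<close>s as \<open>0\<close>s, and two or more \<open>1\<close>s force a single \<open>2\<close>; otherwise \<open>\<lambda>'\<close> is constant up to its first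
  or its last part.
\<close>

section \<open>Exponent vectors of Schur polynomials\<close>

definition top_sum :: "nat list \<Rightarrow> nat \<Rightarrow> nat" where
  "top_sum lam k = sum_list (take k lam)"

definition arrangements :: "nat list \<Rightarrow> (real ^ 'm::finite) set" where
  "arrangements lam = {\<chi> i. real (lam ! w i) | w. bij_betw w UNIV {..<CARD('m)}}"

text \<open>The permutohedron by inequalities. Given the equation for the full sum, the bound for
  \<open>S\<close> also bounds the sum over the complement from below.\<close>

definition rado_polytope :: "nat list \<Rightarrow> (real ^ 'm::finite) set" where
  "rado_polytope lam = {x. (\<Sum>i\<in>UNIV. x $ i) = top_sum lam CARD('m) \<and>
     (\<forall>S. (\<Sum>i\<in>S. x $ i) \<le> top_sum lam (card S))}"

lemma top_sum_eq_sum_nth: "k \<le> length lam \<Longrightarrow> top_sum lam k = (\<Sum>i<k. lam ! i)"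
  by (simp add: top_sum_def sum_list_sum_nth min_def atLeast0LessThan)

lemma prod_var_eq_single:
  "finite D \<Longrightarrow> (\<Prod>c\<in>D. var (T c)) =
     Poly_Mapping.single (\<Sum>c\<in>D. Poly_Mapping.single (T c) (1::nat)) (1::int)"
  by (induction D rule: finite_induct) (auto simp: var_def mult_single)

lemma lookup_sum_single:
  "finite D \<Longrightarrow> Poly_Mapping.lookup (\<Sum>c\<in>D. Poly_Mapping.single (T c) (1::nat)) v =
     card {c \<in> D. T c = v}"
  by (simp add: lookup_sum lookup_single when_def sum.If_cases Collect_conj_eq Int_commute)

text \<open>Each coefficient counts the tableaux of a given content, so no monomial of a tableau
  cancels.\<close>

lemma keys_schur_polynomial:
  "Poly_Mapping.keys (schur_polynomial lam :: ('v::{finite,linorder} \<Rightarrow>\<^sub>0 nat) \<Rightarrow>\<^sub>0 int) =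
     (\<lambda>T. \<Sum>c\<in>young_diagram lam. Poly_Mapping.single (T c) 1) ` ssyt lam"
    (is "_ = ?e ` _")
proof -
  have "Poly_Mapping.lookup (schur_polynomial lam :: ('v \<Rightarrow>\<^sub>0 nat) \<Rightarrow>\<^sub>0 int) e =
      int (card {T \<in> ssyt lam. ?e T = e})" for e
    by (simp add: schur_polynomial_def prod_var_eq_single finite_young_diagram lookup_sum
        lookup_single when_def sum.If_cases finite_ssyt Collect_conj_eq Int_commute eq_commute[of _ e])
  then show ?thesis
    by (auto simp: in_keys_iff finite_ssyt image_iff)
qed

lemma exponent_vectors_schur_polynomial:
  "exponent_vector ` Poly_Mapping.keys
      (schur_polynomial lam :: ('v::{finite,linorder} \<Rightarrow>\<^sub>0 nat) \<Rightarrow>\<^sub>0 int) =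
     (\<lambda>T. \<chi> v. real (card {c \<in> young_diagram lam. T c = v})) ` ssyt lam"
  by (simp add: keys_schur_polynomial image_image exponent_vector_def lookup_sum_single
      finite_young_diagram del: One_nat_def)

lemma nth_decreasing:
  "sorted_wrt (\<ge>) lam \<Longrightarrow> i \<le> j \<Longrightarrow> j < length lam \<Longrightarrow> lam ! j \<le> (lam ! i :: nat)"
  by (metis le_neq_implies_less order_refl sorted_wrt_nth_less)

lemma young_diagram_up_closed:
  "sorted_wrt (\<ge>) lam \<Longrightarrow> (i, j) \<in> young_diagram lam \<Longrightarrow> i' \<le> i \<Longrightarrow> (i', j) \<in> young_diagram lam"
  using nth_decreasing[of lam i' i] by (auto simp: young_diagram_def)

lemma card_young_diagram_rows:
  assumes "k \<le> length lam"
  shows "card {(i, j) \<in> young_diagram lam. i < k} = top_sum lam k"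
proof -
  have "{(i, j) \<in> young_diagram lam. i < k} = (SIGMA i:{..<k}. {..<lam ! i})"
    using assms by (auto simp: young_diagram_def)
  then show ?thesis
    by (simp add: top_sum_eq_sum_nth[OF assms])
qed

section \<open>Rado's inequalities for contents of tableaux\<close>

lemma sum_card_fibres:
  assumes "finite D" "finite S"
  shows "(\<Sum>v\<in>S. card {c \<in> D. f c = v}) = card {c \<in> D. f c \<in> S}"
proof -
  have "{c \<in> D. f c \<in> S} = (\<Union>v\<in>S. {c \<in> D. f c = v})"
    by auto
  then show ?thesis
    using assms by (simp only:) (subst card_UN_disjoint, auto)
qed

text \<open>Sliding the cells with entries in \<open>S\<close> to the top of their columns moves them injectively into
  the first \<open>card S\<close> rows, because the entries of a column are distinct.\<close>

lemma card_entries_le_top_sum: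
  fixes S :: "'v::{finite,linorder} set"
  assumes dec: "sorted_wrt (\<ge>) lam" and T: "T \<in> ssyt lam" and S: "card S \<le> length lam"
  shows "card {c \<in> young_diagram lam. T c \<in> S} \<le> top_sum lam (card S)"
proof -
  \<comment> \<open>The row in which the cell \<open>(i, j)\<close> lands after sliding: the number
    of entries from \<open>S\<close> above it.\<close>
  define r where "r i j = card {i'. i' < i \<and> T (i', j) \<in> S}" for i j
  let ?D = "{c \<in> young_diagram lam. T c \<in> S}"
  have col: "T (i, j) < T (i', j)" if "i < i'" "(i', j) \<in> young_diagram lam" for i i' j
    using T that young_diagram_up_closed[OF dec that(2), of i] by (auto simp: ssyt_def)
  have r_le: "r i j \<le> i" for i j
    using card_mono[of "{..<i}" "{i'. i' < i \<and> T (i', j) \<in> S}"] by (auto simp: r_def)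
  have r_less: "r i j < card S" if "(i, j) \<in> ?D" for i j
  proof -
    \<comment> \<open>Including row \<open>i\<close> itself counts \<open>r i j + 1\<close> distinct
      elements of \<open>S\<close>, which gives the strict bound.\<close>
    have "inj_on (\<lambda>i'. T (i', j)) {i'. i' < Suc i \<and> T (i', j) \<in> S}"
    proof (rule linorder_inj_onI)
      fix x y
      assume "x < y" "x \<in> {i'. i' < Suc i \<and> T (i', j) \<in> S}" "y \<in> {i'. i' < Suc i \<and> T (i', j) \<in> S}"
      with that have "T (x, j) < T (y, j)"
        by (intro col) (auto intro: young_diagram_up_closed[OF dec, of i])
      then show "T (x, j) \<noteq> T (y, j)" by simp
    qed auto
    then have "card {i'. i' < Suc i \<and> T (i', j) \<in> S} \<le> card S"
      by (rule card_inj_on_le) auto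
    moreover have "{i'. i' < Suc i \<and> T (i', j) \<in> S} = insert i {i'. i' < i \<and> T (i', j) \<in> S}"
      using that by (auto simp: less_Suc_eq)
    ultimately show ?thesis by (simp add: r_def)
  qed
  have r_strict: "r i j < r i' j" if "(i, j) \<in> ?D" "i < i'" for i i' j
    unfolding r_def using that by (intro psubset_card_mono) auto
  have "inj_on (\<lambda>(i, j). (r i j, j)) ?D"
  proof (rule inj_onI)
    fix c c'
    assume "c \<in> ?D" "c' \<in> ?D"
      "(case c of (i, j) \<Rightarrow> (r i j, j)) = (case c' of (i, j) \<Rightarrow> (r i j, j))"
    then show "c = c'"
      using r_strict[of "fst c" "snd c" "fst c'"] r_strict[of "fst c'" "snd c'" "fst c"]
      by (cases c; cases c'; cases "fst c" "fst c'" rule: linorder_cases) auto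
  qed
  moreover have "(\<lambda>(i, j). (r i j, j)) ` ?D \<subseteq> {(i, j) \<in> young_diagram lam. i < card S}"
    using r_less r_le young_diagram_up_closed[OF dec] by fastforce
  moreover have "finite {(i, j) \<in> young_diagram lam. i < card S}"
    by (rule finite_subset[OF _ finite_young_diagram[of lam]]) auto
  ultimately have "card ?D \<le> card {(i, j) \<in> young_diagram lam. i < card S}"
    by (rule card_inj_on_le)
  then show ?thesis
    by (simp add: card_young_diagram_rows[OF S])
qed

lemma exponent_vectors_subset_rado_polytope:
  assumes dec: "sorted_wrt (\<ge>) lam" and len: "length lam = CARD('m::{finite,linorder})"
  shows "exponent_vector ` Poly_Mapping.keys (schur_polynomial lam :: ('m \<Rightarrow>\<^sub>0 nat) \<Rightarrow>\<^sub>0 int)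
    \<subseteq> rado_polytope lam"
proof -
  have "(\<chi> v. real (card {c \<in> young_diagram lam. T c = v})) \<in> rado_polytope lam"
    if T: "T \<in> ssyt lam" for T :: "nat \<times> nat \<Rightarrow> 'm"
  proof -
    have sum: "(\<Sum>v\<in>S. real (card {c \<in> young_diagram lam. T c = v})) =
        real (card {c \<in> young_diagram lam. T c \<in> S})" for S
      using sum_card_fibres[OF finite_young_diagram[of lam], of S T]
      by (simp flip: of_nat_sum)
    have "young_diagram lam = {(i, j) \<in> young_diagram lam. i < length lam}"
      by (auto simp: young_diagram_def)
    then have "card (young_diagram lam) = top_sum lam CARD('m)"
      using card_young_diagram_rows[of "length lam" lam] len by simp
    then show ?thesis
      using card_entries_le_top_sum[OF dec T] card_mono[of "UNIV :: 'm set"]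
      by (simp add: rado_polytope_def sum len)
  qed
  then show ?thesis
    by (auto simp: exponent_vectors_schur_polynomial)
qed

text \<open>Pigeonhole: if the element of \<open>B\<close> at index \<open>i\<close> were the
  smaller one, the \<open>i + 1\<close> elements of \<open>B\<close> up to it would all lie among
  the first \<open>i\<close> elements of \<open>A\<close>. This makes the rows of the key tableau
  weakly increase.\<close>

lemma sorted_list_of_set_nth_antimono:
  fixes A B :: "'a::linorder set"
  assumes "finite A" "B \<subseteq> A" "i < card B"
  shows "sorted_list_of_set A ! i \<le> sorted_list_of_set B ! i"
proof (rule ccontr)
  let ?a = "\<lambda>i. sorted_list_of_set A ! i" and ?b = "\<lambda>i. sorted_list_of_set B ! i"
  assume "\<not> ?a i \<le> ?b i"
  then have less: "?b i < ?a i" by simp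
  have B: "finite B" using assms finite_subset by blast
  have "card B \<le> card A" using assms card_mono by blast
  have b: "sorted_wrt (<) (sorted_list_of_set B)" and a: "sorted_wrt (<) (sorted_list_of_set A)"
    by (rule strict_sorted_list_of_set)+
  have "?b ` {..i} \<subseteq> ?a ` {..<i}"
  proof clarify
    fix j assume "j \<le> i"
    have "?b j \<in> A"
      using nth_mem[of j "sorted_list_of_set B"] B assms \<open>j \<le> i\<close> by auto
    then obtain k where k: "k < card A" "?a k = ?b j"
      using set_sorted_list_of_set[OF \<open>finite A\<close>] by (metis in_set_conv_nth length_sorted_list_of_set)
    have "?b j \<le> ?b i"
      using sorted_nth_mono[of "sorted_list_of_set B" j i] \<open>j \<le> i\<close> assms by auto
    have "k < i"
    proof (rule ccontr)
      assume "\<not> k < i"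
      then have "?a i \<le> ?a k"
        using sorted_nth_mono[of "sorted_list_of_set A" i k] k by auto
      with less k \<open>?b j \<le> ?b i\<close> show False by simp
    qed
    then show "?b j \<in> ?a ` {..<i}" using k by (metis imageI lessThan_iff)
  qed
  then have "card (?b ` {..i}) \<le> card (?a ` {..<i})"
    by (intro card_mono) auto
  moreover have "card (?a ` {..<i}) \<le> i"
    using card_image_le[of "{..<i}" ?a] by simp
  moreover have "inj_on ?b {..i}"
    using assms B by (auto intro!: inj_on_nth)
  then have "card (?b ` {..i}) = Suc i"
    by (simp add: card_image)
  ultimately show False by simp
qed

text \<open>The key tableau: column \<open>j\<close> lists the letters \<open>v\<close> with \<open>w v\<close> less than the length of the
  column. These sets are nested, so the rows weakly increase.\<close>

lemma arrangements_subset_exponent_vectors: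
  assumes dec: "sorted_wrt (\<ge>) lam" and len: "length lam = CARD('m::{finite,linorder})"
  shows "arrangements lam \<subseteq>
    exponent_vector ` Poly_Mapping.keys (schur_polynomial lam :: ('m \<Rightarrow>\<^sub>0 nat) \<Rightarrow>\<^sub>0 int)"
proof -
  have "(\<chi> v. real (lam ! w v)) \<in>
      (\<lambda>T. \<chi> v. real (card {c \<in> young_diagram lam. T c = v})) ` ssyt lam"
    if w: "bij_betw w UNIV {..<CARD('m)}" for w :: "'m \<Rightarrow> nat"
  proof -
    \<comment> \<open>The length of column \<open>j\<close>, a part of the conjugate
      partition.\<close>
    define h where "h j = card {i. i < length lam \<and> j < lam ! i}" for j
    define C where "C j = {v. w v < h j}" for j
    define T where "T = restrict (\<lambda>(i, j). sorted_list_of_set (C j) ! i) (young_diagram lam)"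
    have column: "{i. i < length lam \<and> j < lam ! i} = {..<h j}" for j
    proof -
      let ?I = "{i. i < length lam \<and> j < lam ! i}"
      have down: "i \<in> ?I" if "i \<le> i'" "i' \<in> ?I" for i i'
        using nth_decreasing[OF dec \<open>i \<le> i'\<close>] that by auto
      have "?I \<subseteq> {..<h j}"
      proof
        fix i assume "i \<in> ?I"
        then have "{..i} \<subseteq> ?I" using down by blast
        from card_mono[OF _ this] show "i \<in> {..<h j}" by (simp add: h_def)
      qed
      then show ?thesis
        by (intro card_subset_eq) (auto simp: h_def)
    qed
    have D: "(i, j) \<in> young_diagram lam \<longleftrightarrow> i < h j" for i j
      using column[of j] by (auto simp: young_diagram_def)
    have h_anti: "h j' \<le> h j" if "j \<le> j'" for j j'
      unfolding h_def using that by (intro card_mono) auto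
    have h_le: "h j \<le> CARD('m)" for j
      using card_mono[of "{..<length lam}" "{i. i < length lam \<and> j < lam ! i}"]
      by (auto simp: h_def len)
    have card_C: "card (C j) = h j" for j
    proof -
      have "bij_betw w (C j) {..<h j}"
        unfolding bij_betw_def
      proof
        show "inj_on w (C j)" using w by (auto simp: bij_betw_def inj_on_def)
        show "w ` C j = {..<h j}"
        proof
          show "{..<h j} \<subseteq> w ` C j"
          proof
            fix i assume i: "i \<in> {..<h j}"
            then have "i \<in> range w" using w h_le[of j] by (auto simp: bij_betw_def)
            then show "i \<in> w ` C j" using i by (auto simp: C_def)
          qed
        qed (auto simp: C_def)
      qed
      then show ?thesis using bij_betw_same_card by fastforce
    qed
    have T_eq: "T (i, j) = sorted_list_of_set (C j) ! i" if "i < h j" for i j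
      using that by (simp add: T_def D)
    have "T (i, j) \<le> T (i, j')" if "j < j'" "i < h j'" for i j j'
    proof -
      have "C j' \<subseteq> C j" using h_anti[of j j'] that by (auto simp: C_def)
      then show ?thesis
        using that h_anti[of j j'] by (auto simp: T_eq card_C intro!: sorted_list_of_set_nth_antimono)
    qed
    moreover have "T (i, j) < T (i', j)" if "i < i'" "i' < h j" for i i' j
      using that sorted_wrt_nth_less[OF strict_sorted_list_of_set, of i i' "C j"]
      by (simp add: T_eq card_C)
    ultimately have "T \<in> ssyt lam"
      by (auto simp: ssyt_def D PiE_def) (simp add: T_def)
    moreover have "card {c \<in> young_diagram lam. T c = v} = lam ! w v" for v
    proof -
      have wv: "w v < length lam" using w len by (auto simp: bij_betw_def)
      have nth_inj: "inj_on (\<lambda>i. sorted_list_of_set (C j) ! i) {..<h j}" for j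
        by (intro inj_on_nth) (auto simp: card_C)
      have img: "(\<lambda>i. sorted_list_of_set (C j) ! i) ` {..<h j} = C j" for j
        using set_conv_nth[of "sorted_list_of_set (C j)"] by (auto simp: card_C)
      \<comment> \<open>A letter occurs at most once in a column, and exactly in the columns
        \<open>j < lam ! w v\<close>, so its cells are counted by their column index.\<close>
      have "bij_betw snd {c \<in> young_diagram lam. T c = v} {..<lam ! w v}"
        unfolding bij_betw_def
      proof
        show "inj_on snd {c \<in> young_diagram lam. T c = v}"
        proof (rule inj_onI, clarsimp simp: D)
          fix i i' j
          assume "i < h j" "i' < h j" "T (i', j) = T (i, j)"
          then show "i = i'"
            using nth_inj[of j] by (auto simp: T_eq inj_on_def)
        qed
        show "snd ` {c \<in> young_diagram lam. T c = v} = {..<lam ! w v}"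
        proof -
          have "(\<exists>i. i < h j \<and> T (i, j) = v) \<longleftrightarrow> v \<in> C j" for j
            using img[of j] T_eq by (force simp: image_iff)
          moreover have "v \<in> C j \<longleftrightarrow> j < lam ! w v" for j
            using column[of j] wv by (auto simp: C_def)
          ultimately show ?thesis by (force simp: D image_iff)
        qed
      qed
      then show ?thesis using bij_betw_same_card by fastforce
    qed
    ultimately show ?thesis by (intro image_eqI[of _ _ T]) auto
  qed
  then show ?thesis
    unfolding exponent_vectors_schur_polynomial by (auto simp: arrangements_def)
qed

section \<open>The polytope of rearrangements\<close>

lemma summation_by_parts:
  fixes a x :: "nat \<Rightarrow> real"
  shows "(\<Sum>k<Suc n. a k * x k) =
    (\<Sum>k<n. (a k - a (Suc k)) * (\<Sum>j<Suc k. x j)) + a n * (\<Sum>j<Suc n. x j)"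
  by (induction n) (simp_all add: algebra_simps)

text \<open>Removing \<open>A\<close> and its image leaves sets of equal size, and any bijection
  between these completes \<open>f\<close>. It serves to complete prescribed entries to an
  arrangement.\<close>

lemma bij_betw_extend:
  assumes "finite S" "finite T" "card S = card T" "A \<subseteq> S" "inj_on f A" "f ` A \<subseteq> T"
  shows "\<exists>g. bij_betw g S T \<and> (\<forall>x\<in>A. g x = f x)"
proof -
  have "finite A" using assms finite_subset by blast
  have "card (S - A) = card (T - f ` A)"
    using assms \<open>finite A\<close> by (simp add: card_Diff_subset card_image)
  then obtain h where h: "bij_betw h (S - A) (T - f ` A)"
    using assms finite_same_card_bij[of "S - A" "T - f ` A"] by auto
  define g where "g x = (if x \<in> A then f x else h x)" for x
  have "bij_betw g A (f ` A)"
    using \<open>inj_on f A\<close> by (auto simp: bij_betw_def g_def inj_on_def)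
  moreover have "bij_betw g (S - A) (T - f ` A)"
    using h by (subst bij_betw_cong[of _ _ h]) (auto simp: g_def)
  ultimately have "bij_betw g (A \<union> (S - A)) (f ` A \<union> (T - f ` A))"
    by (rule bij_betw_combine) auto
  moreover have "A \<union> (S - A) = S" "f ` A \<union> (T - f ` A) = T"
    using assms by auto
  ultimately show ?thesis
    by (auto simp: g_def intro!: exI[of _ g])
qed

text \<open>The normal vector of the inequality for \<open>S\<close>; it turns sums over
  \<open>S\<close> into inner products.\<close>

definition indicator_vec :: "'m::finite set \<Rightarrow> real ^ 'm" where
  "indicator_vec S = (\<chi> i. if i \<in> S then 1 else 0)"

lemma indicator_vec_inner: "indicator_vec S \<bullet> x = (\<Sum>i\<in>S. x $ i)"
proof -
  have "indicator_vec S \<bullet> x = (\<Sum>i\<in>UNIV. if i \<in> S then x $ i else 0)"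
    unfolding indicator_vec_def inner_vec_def by (intro sum.cong) auto
  then show ?thesis by (simp add: sum.If_cases)
qed

definition face_at :: "nat list \<Rightarrow> 'm::finite set \<Rightarrow> (real ^ 'm) set" where
  "face_at lam S = rado_polytope lam \<inter> {x. indicator_vec S \<bullet> x = top_sum lam (card S)}"

text \<open>Lists are indexed from \<open>0\<close>: \<open>lam ! (k - 1)\<close> and
  \<open>lam ! k\<close> are the \<open>k\<close>-th part and the next one. For nonconstant
  \<open>lam\<close> these turn out to be the sizes of the proper nonempty sets \<open>S\<close>
  whose face is a facet.\<close>

definition facet_index :: "nat list \<Rightarrow> nat \<Rightarrow> bool" where
  "facet_index lam k \<longleftrightarrow> (k = 1 \<or> lam ! (k - 1) < lam ! 0) \<and>
     (k = length lam - 1 \<or> lam ! (length lam - 1) < lam ! k)"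

lemma top_sum_Suc: "k < length lam \<Longrightarrow> top_sum lam (Suc k) = top_sum lam k + lam ! k"
  by (simp add: top_sum_def take_Suc_conv_app_nth)

lemma top_sum_const_block:
  assumes "k \<le> l" "l \<le> length lam" "\<And>i. k \<le> i \<Longrightarrow> i < l \<Longrightarrow> lam ! i = c"
  shows "top_sum lam l = top_sum lam k + (l - k) * c"
  using assms by (induction rule: dec_induct) (auto simp: top_sum_Suc Suc_diff_le)

lemma rado_polytope_iff:
  "(x :: real ^ 'm::finite) \<in> rado_polytope lam \<longleftrightarrow> indicator_vec UNIV \<bullet> x = top_sum lam CARD('m) \<and>
     (\<forall>S. indicator_vec S \<bullet> x \<le> top_sum lam (card S))"
  by (simp add: rado_polytope_def indicator_vec_inner)

lemma indicator_vec_le_top_sum: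
  "x \<in> rado_polytope lam \<Longrightarrow> indicator_vec S \<bullet> x \<le> top_sum lam (card S)"
  by (simp add: rado_polytope_iff)

lemma indicator_vec_UNIV_eq_top_sum:
  "(x :: real ^ 'm::finite) \<in> rado_polytope lam \<Longrightarrow> indicator_vec UNIV \<bullet> x = top_sum lam CARD('m)"
  by (simp add: rado_polytope_iff)

lemma card_Compl: "card (- S) = CARD('m) - card S" for S :: "'m::finite set"
  by (simp add: Compl_eq_Diff_UNIV card_Diff_subset)

lemma indicator_vec_Compl: "indicator_vec (- S) \<bullet> x = indicator_vec UNIV \<bullet> x - indicator_vec S \<bullet> x"
proof -
  have "(\<Sum>i\<in>UNIV. x $ i) = (\<Sum>i\<in>S. x $ i) + (\<Sum>i\<in>-S. x $ i)"
    by (subst sum.union_disjoint[symmetric]) auto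
  then show ?thesis by (simp add: indicator_vec_inner)
qed

lemma convex_rado_polytope: "convex (rado_polytope lam)"
  unfolding convex_def rado_polytope_iff inner_add_right inner_scaleR_right
proof (intro ballI allI impI)
  fix x y :: "real ^ 'a" and u v :: real
  assume x: "x \<in> rado_polytope lam" and y: "y \<in> rado_polytope lam" and uv: "0 \<le> u" "0 \<le> v" "u + v = 1"
  have "u * (indicator_vec S \<bullet> x) + v * (indicator_vec S \<bullet> y) \<le> real (top_sum lam (card S))" for S
    using convex_bound_le[of "indicator_vec S \<bullet> x" "real (top_sum lam (card S))" "indicator_vec S \<bullet> y" u v]
      x y uv by (auto simp: rado_polytope_iff)
  then show "u * (indicator_vec UNIV \<bullet> x) + v * (indicator_vec UNIV \<bullet> y) = real (top_sum lam CARD('a)) \<and>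
      (\<forall>S. u * (indicator_vec S \<bullet> x) + v * (indicator_vec S \<bullet> y) \<le> real (top_sum lam (card S)))"
    using x y uv by (auto simp: rado_polytope_iff simp flip: distrib_right)
qed

section \<open>Linear functionals on the polytope and Rado's theorem\<close>

context
  fixes lam :: "nat list"
  assumes decreasing: "sorted_wrt (\<ge>) lam" and length_lam: "length lam = CARD('m::{finite,linorder})"
begin

lemma arrangements_subset_rado: "(arrangements lam :: (real, 'm) vec set) \<subseteq> rado_polytope lam"
  using arrangements_subset_exponent_vectors[OF decreasing length_lam]
    exponent_vectors_subset_rado_polytope[OF decreasing length_lam] by blast

lemma finite_arrangements: "finite (arrangements lam :: (real, 'm) vec set)"
  using arrangements_subset_exponent_vectors[OF decreasing length_lam]
  by (rule finite_subset) simp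

text \<open>A linear functional is maximized by arranging the parts in the order of its coefficients:
  summation by parts writes it as a combination of the sums over the sets of the largest
  coefficients, with the gaps between consecutive coefficients as weights.\<close>

lemma linear_functional_maximum:
  fixes a :: "(real, 'm) vec"
  obtains v where "v \<in> arrangements lam" "\<And>x. x \<in> rado_polytope lam \<Longrightarrow> a \<bullet> x \<le> a \<bullet> v"
    "(\<exists>i j. a $ i \<noteq> a $ j) \<Longrightarrow>
       \<exists>S. S \<noteq> {} \<and> S \<noteq> UNIV \<and> {x \<in> rado_polytope lam. a \<bullet> x = a \<bullet> v} \<subseteq> face_at lam S"
proof -
  obtain n where n: "CARD('m) = Suc n"
    using not0_implies_Suc[of "CARD('m)"] by auto
  \<comment> \<open>The coordinates in order of decreasing coefficient, hence the minus sign in the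
    sort key.\<close>
  define xs where "xs = sort_key (\<lambda>i. - a $ i) (sorted_list_of_set UNIV)"
  define e where "e k = xs ! k" for k
  have xs: "set xs = UNIV" "distinct xs" "length xs = CARD('m)"
    by (simp_all add: xs_def)
  have e: "bij_betw e {..<CARD('m)} UNIV"
    unfolding e_def using bij_betw_nth[OF xs(2), of "{..<CARD('m)}" UNIV] xs by auto
  have mono: "a $ e (Suc k) \<le> a $ e k" if "k < n" for k
    using sorted_nth_mono[of "map (\<lambda>i. - a $ i) xs" k "Suc k"] that xs n
    by (simp add: e_def) (simp add: xs_def)
  \<comment> \<open>The rank of a coordinate in this order, so that the largest part meets the
    largest coefficient.\<close>
  define w where "w = inv_into {..<CARD('m)} e"
  have w: "bij_betw w UNIV {..<CARD('m)}"
    unfolding w_def using e by (rule bij_betw_inv_into)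
  have we: "w (e k) = k" if "k < CARD('m)" for k
    unfolding w_def using e that by (simp add: bij_betw_inv_into_left)
  define v :: "(real, 'm) vec" where "v = (\<chi> i. real (lam ! w i))"
  have v: "v \<in> arrangements lam"
    using w by (auto simp: arrangements_def v_def)
  have inj: "inj_on e {..<k}" if "k \<le> CARD('m)" for k
    using e that by (auto simp: bij_betw_def inj_on_def)
  define X where "X k x = (\<Sum>j<k. x $ e j)" for k and x :: "(real, 'm) vec"
  have X_eq: "X k x = indicator_vec (e ` {..<k}) \<bullet> x" if "k \<le> CARD('m)" for k x
    using inj[OF that] by (simp add: X_def indicator_vec_inner sum.reindex)
  have card_e: "card (e ` {..<k}) = k" if "k \<le> CARD('m)" for k
    using inj[OF that] by (simp add: card_image)
  have range_e: "e ` {..<CARD('m)} = UNIV"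
    using e by (auto simp: bij_betw_def)
  have inner: "a \<bullet> x = (\<Sum>k<n. (a $ e k - a $ e (Suc k)) * X (Suc k) x) + a $ e n * X (Suc n) x" for x
  proof -
    have "a \<bullet> x = (\<Sum>k<Suc n. a $ e k * x $ e k)"
      using sum.reindex_bij_betw[OF e, of "\<lambda>i. a $ i * x $ i"] by (simp add: inner_vec_def n)
    then show ?thesis
      by (simp only: X_def summation_by_parts)
  qed
  have X_le: "X k x \<le> top_sum lam k" if "k \<le> CARD('m)" "x \<in> rado_polytope lam" for k x
    using indicator_vec_le_top_sum[OF that(2), of "e ` {..<k}"] card_e[OF that(1)]
    by (simp add: X_eq[OF that(1)])
  have X_total: "X (Suc n) x = top_sum lam (Suc n)" if "x \<in> rado_polytope lam" for x
    using indicator_vec_UNIV_eq_top_sum[OF that] X_eq[of "Suc n" x] range_e n by simp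
  have X_v: "X k v = top_sum lam k" if "k \<le> CARD('m)" for k
    using that we by (simp add: X_def v_def top_sum_eq_sum_nth length_lam)
  \<comment> \<open>The last terms of the two expansions agree because the total is fixed on the
    polytope; what remains is a sum of nonnegative terms.\<close>
  have gap: "a \<bullet> v - a \<bullet> x =
      (\<Sum>k<n. (a $ e k - a $ e (Suc k)) * (top_sum lam (Suc k) - X (Suc k) x))"
    if "x \<in> rado_polytope lam" for x
    using that by (simp add: inner X_total X_v n right_diff_distrib sum_subtractf)
  have gap_nonneg: "0 \<le> (a $ e k - a $ e (Suc k)) * (top_sum lam (Suc k) - X (Suc k) x)"
    if "k < n" "x \<in> rado_polytope lam" for k x
    using mono[OF that(1)] X_le[of "Suc k" x] that n by simp
  have max: "a \<bullet> x \<le> a \<bullet> v" if "x \<in> rado_polytope lam" for x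
    using gap[OF that] sum_nonneg[of "{..<n}"] gap_nonneg[OF _ that] by (smt (verit) lessThan_iff)
  have "\<exists>S. S \<noteq> {} \<and> S \<noteq> UNIV \<and> {x \<in> rado_polytope lam. a \<bullet> x = a \<bullet> v} \<subseteq> face_at lam S"
    if nonconst: "\<exists>i j. a $ i \<noteq> a $ j"
  proof -
    \<comment> \<open>A strict drop of the coefficients carries positive weight, so every maximizer
      attains equality on the \<open>k + 1\<close> leading coordinates, which form the desired
      \<open>S\<close>.\<close>
    obtain k where k: "k < n" "a $ e k \<noteq> a $ e (Suc k)"
    proof (rule ccontr)
      assume "\<not> thesis"
      then have step: "a $ e k = a $ e (Suc k)" if "k < n" for k
        using \<open>\<And>k. \<lbrakk>k < n; a $ e k \<noteq> a $ e (Suc k)\<rbrakk> \<Longrightarrow> thesis\<close> that by blast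
      have "k \<le> n \<Longrightarrow> a $ e k = a $ e 0" for k
        by (induction k) (auto simp flip: step)
      then have "a $ i = a $ e 0" for i
        using range_e n by (metis UNIV_I imageE less_Suc_eq_le lessThan_iff)
      then show False using nonconst by metis
    qed
    have "X (Suc k) x = top_sum lam (Suc k)" if "x \<in> rado_polytope lam" "a \<bullet> x = a \<bullet> v" for x
    proof -
      have "(\<Sum>k<n. (a $ e k - a $ e (Suc k)) * (top_sum lam (Suc k) - X (Suc k) x)) = 0"
        using gap[OF that(1)] that(2) by simp
      then have "(a $ e k - a $ e (Suc k)) * (top_sum lam (Suc k) - X (Suc k) x) = 0"
        using gap_nonneg[OF _ that(1)] k by (subst (asm) sum_nonneg_eq_0_iff) auto
      then show ?thesis using k by simp
    qed
    moreover have "e ` {..<Suc k} \<noteq> UNIV"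
      using card_e[of "Suc k"] k n by auto
    ultimately show ?thesis
      using k n card_e[of "Suc k"] by (intro exI[of _ "e ` {..<Suc k}"]) (auto simp: face_at_def X_eq)
  qed
  then show ?thesis using that v max by blast
qed

text \<open>A point outside the hull would be strictly separated from it by a functional, but every
  functional attains its maximum over the polytope at an arrangement.\<close>

lemma rado_polytope_eq_convex_hull: "rado_polytope lam = convex hull (arrangements lam :: (real, 'm) vec set)"
proof
  show "convex hull (arrangements lam :: (real, 'm) vec set) \<subseteq> rado_polytope lam"
    using arrangements_subset_rado convex_rado_polytope by (rule hull_minimal)
  show "rado_polytope lam \<subseteq> convex hull (arrangements lam :: (real, 'm) vec set)"
  proof (rule ccontr)
    assume "\<not> ?thesis"
    then obtain z :: "(real, 'm) vec" where z: "z \<in> rado_polytope lam" "z \<notin> convex hull (arrangements lam)"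
      by auto
    have "closed (convex hull (arrangements lam :: (real, 'm) vec set))"
      using finite_arrangements by (simp add: compact_imp_closed finite_imp_compact_convex_hull)
    then obtain a b where ab: "a \<bullet> z < b" "\<And>x. x \<in> convex hull (arrangements lam) \<Longrightarrow> b < a \<bullet> x"
      using separating_hyperplane_closed_point[OF convex_convex_hull _ z(2)] by metis
    obtain v where v: "v \<in> arrangements lam" "(-a) \<bullet> z \<le> (-a) \<bullet> v"
      using linear_functional_maximum[of "-a"] z(1) by metis
    then show False
      using ab(1) ab(2)[OF hull_inc[OF v(1)]] by simp
  qed
qed

text \<open>The exponent vectors include all arrangements and lie in the polytope, which is the hull
  of the arrangements.\<close>

lemma Newt_schur_polynomial:
  "Newt (schur_polynomial lam :: ('m \<Rightarrow>\<^sub>0 nat) \<Rightarrow>\<^sub>0 int) = rado_polytope lam"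
  unfolding Newt_def
proof
  show "convex hull (exponent_vector ` Poly_Mapping.keys
      (schur_polynomial lam :: ('m \<Rightarrow>\<^sub>0 nat) \<Rightarrow>\<^sub>0 int)) \<subseteq> rado_polytope lam"
    using exponent_vectors_subset_rado_polytope[OF decreasing length_lam] convex_rado_polytope
    by (rule hull_minimal)
  show "rado_polytope lam \<subseteq> convex hull (exponent_vector ` Poly_Mapping.keys
      (schur_polynomial lam :: ('m \<Rightarrow>\<^sub>0 nat) \<Rightarrow>\<^sub>0 int))"
    unfolding rado_polytope_eq_convex_hull
    using arrangements_subset_exponent_vectors[OF decreasing length_lam] by (rule hull_mono)
qed

lemma lattice_polytope_rado: "lattice_polytope (rado_polytope lam :: (real, 'm) vec set)"
  unfolding lattice_polytope_def rado_polytope_eq_convex_hull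
  using finite_arrangements by (intro exI[of _ "arrangements lam"])
    (auto simp: arrangements_def lattice_point_def)

lemma polyhedron_rado: "polyhedron (rado_polytope lam :: (real, 'm) vec set)"
  unfolding rado_polytope_eq_convex_hull
  using finite_arrangements polytope_convex_hull polytope_imp_polyhedron by blast

text \<open>Giving the first \<open>card S\<close> positions to the coordinates in \<open>S\<close>
  puts an arrangement on the face. The positions prescribed by \<open>f\<close> respect this
  division, so \<open>f\<close> can be completed on \<open>S\<close> and on its complement
  separately.\<close>

lemma arrangement_with_entries:
  fixes S A :: "'m set" and f :: "'m \<Rightarrow> nat"
  assumes f: "inj_on f A" "\<And>i. i \<in> A \<Longrightarrow> f i < CARD('m)" "\<And>i. i \<in> A \<Longrightarrow> f i < card S \<longleftrightarrow> i \<in> S"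
  shows "\<exists>v\<in>arrangements lam \<inter> face_at lam S. \<forall>i\<in>A. v $ i = lam ! f i"
proof -
  have card_S: "card S \<le> CARD('m)" by (simp add: card_mono)
  have "\<exists>g. bij_betw g S {..<card S} \<and> (\<forall>i\<in>A \<inter> S. g i = f i)"
    using f by (intro bij_betw_extend) (auto simp: inj_on_def)
  then obtain g where g: "bij_betw g S {..<card S}" "\<And>i. i \<in> A \<inter> S \<Longrightarrow> g i = f i"
    by auto
  have "f i \<in> {card S..<CARD('m)}" if "i \<in> A \<inter> - S" for i
    using f(2,3)[of i] that by auto
  then have "\<exists>h. bij_betw h (- S) {card S..<CARD('m)} \<and> (\<forall>i\<in>A \<inter> - S. h i = f i)"
    using f(1) card_Compl by (intro bij_betw_extend) (auto simp: inj_on_def)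
  then obtain h where h: "bij_betw h (- S) {card S..<CARD('m)}" "\<And>i. i \<in> A \<inter> - S \<Longrightarrow> h i = f i"
    by auto
  define w where "w i = (if i \<in> S then g i else h i)" for i
  have wS: "bij_betw w S {..<card S}"
    using g(1) by (subst bij_betw_cong[of _ _ g]) (auto simp: w_def)
  have wC: "bij_betw w (- S) {card S..<CARD('m)}"
    using h(1) by (subst bij_betw_cong[of _ _ h]) (auto simp: w_def)
  have w: "bij_betw w UNIV {..<CARD('m)}"
    using bij_betw_combine[OF wS wC] card_S
    by (simp add: Un_commute ivl_disj_un ivl_disj_int)
  define v :: "(real, 'm) vec" where "v = (\<chi> i. real (lam ! w i))"
  have v: "v \<in> arrangements lam"
    using w by (auto simp: arrangements_def v_def)
  have "indicator_vec S \<bullet> v = top_sum lam (card S)"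
    using sum.reindex_bij_betw[OF wS, of "\<lambda>k. real (lam ! k)"] card_S
    by (simp add: v_def indicator_vec_inner top_sum_eq_sum_nth length_lam)
  then have "v \<in> face_at lam S"
    using arrangements_subset_rado v by (auto simp: face_at_def)
  with v show ?thesis
    using g(2) h(2) by (intro bexI[of _ v]) (auto simp: v_def w_def)
qed

lemma arrangement_with_two_entries:
  fixes S :: "'m set"
  assumes "a \<noteq> b" "p \<noteq> q" "p < CARD('m)" "q < CARD('m)" "p < card S \<longleftrightarrow> a \<in> S" "q < card S \<longleftrightarrow> b \<in> S"
  obtains v where "v \<in> arrangements lam" "v \<in> face_at lam S" "v $ a = lam ! p" "v $ b = lam ! q"
proof -
  have "\<exists>v\<in>arrangements lam \<inter> face_at lam S. \<forall>i\<in>{a, b}. v $ i = lam ! (if i = a then p else q)"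
    using assms by (intro arrangement_with_entries) (auto simp: inj_on_def)
  then show ?thesis using that assms(1) by auto
qed

text \<open>The vector is \<open>v\<close> with the entries at \<open>a\<close> and \<open>b\<close>
  exchanged, written so that its inner products compare directly with those of
  \<open>v\<close>.\<close>

lemma arrangement_transpose:
  fixes v :: "(real, 'm) vec"
  assumes "v \<in> arrangements lam"
  shows "v + (v $ b - v $ a) *\<^sub>R (axis a 1 - axis b 1) \<in> arrangements lam"
proof -
  obtain w where w: "bij_betw w UNIV {..<CARD('m)}" "v = (\<chi> i. real (lam ! w i))"
    using assms by (auto simp: arrangements_def)
  have "v + (v $ b - v $ a) *\<^sub>R (axis a 1 - axis b 1) = (\<chi> i. real (lam ! (w \<circ> Transposition.transpose a b) i))"
    by (auto simp: vec_eq_iff w axis_def Transposition.transpose_def)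
  moreover have "bij_betw (w \<circ> Transposition.transpose a b) UNIV {..<CARD('m)}"
    using w(1) by (intro bij_betw_trans[of _ _ UNIV]) auto
  ultimately show ?thesis
    unfolding arrangements_def by blast
qed

lemma indicator_vec_axis_diff:
  "a \<in> T \<Longrightarrow> b \<notin> T \<Longrightarrow> indicator_vec T \<bullet> (axis a 1 - axis b 1 :: (real, 'm) vec) = 1"
  by (simp add: inner_diff_right inner_axis indicator_vec_def)

text \<open>Exchanging the two entries would raise the sum over \<open>T\<close> above its
  bound.\<close>

lemma exchange_not_in_face:
  fixes v :: "(real, 'm) vec"
  assumes "v \<in> arrangements lam" "a \<in> T" "b \<notin> T" "v $ a < v $ b"
  shows "v \<notin> face_at lam T"
proof
  assume "v \<in> face_at lam T"
  moreover have "indicator_vec T \<bullet> (v + (v $ b - v $ a) *\<^sub>R (axis a 1 - axis b 1)) \<le> top_sum lam (card T)"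
    using arrangement_transpose[OF assms(1)] arrangements_subset_rado
    by (auto simp: rado_polytope_iff subset_iff)
  ultimately show False
    using assms indicator_vec_axis_diff[OF assms(2,3)]
    by (simp add: face_at_def inner_add_right)
qed

lemma face_at_face_of: "(face_at lam S :: (real, 'm) vec set) face_of rado_polytope lam"
  unfolding face_at_def
  by (rule face_of_Int_supporting_hyperplane_le[OF convex_rado_polytope])
    (auto simp: rado_polytope_iff)

lemma face_at_nonempty: "(face_at lam S :: (real, 'm) vec set) \<noteq> {}"
  using arrangement_with_entries[of _ "{}" S] by auto

section \<open>Faces and facets for nonconstant \<open>lam\<close>\<close>

context
  assumes nonconstant: "lam ! (CARD('m) - 1) < lam ! 0"
begin

lemma card_ge_2: "CARD('m) \<ge> 2"
proof (rule ccontr)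
  assume "\<not> ?thesis"
  then have "CARD('m) - 1 = 0" by simp
  then show False using nonconstant by simp
qed

text \<open>The tool for telling faces apart: an arrangement on the face of \<open>S\<close> with
  the smaller part at \<open>a\<close> and the larger one at \<open>b\<close> does not maximize the
  sum over \<open>T\<close>.\<close>

lemma exchange_arrangement:
  fixes S T :: "'m set"
  assumes "a \<in> T" "b \<notin> T" "p < CARD('m)" "q < CARD('m)" "lam ! p < lam ! q"
    "p < card S \<longleftrightarrow> a \<in> S" "q < card S \<longleftrightarrow> b \<in> S"
  shows "\<not> face_at lam S \<subseteq> (face_at lam T :: (real, 'm) vec set)"
proof -
  have "a \<noteq> b" "p \<noteq> q" using assms by auto
  then obtain v :: "(real, 'm) vec"
    where v: "v \<in> arrangements lam" "v \<in> face_at lam S" "v $ a = lam ! p" "v $ b = lam ! q"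
    using arrangement_with_two_entries[of a b p q S] assms by metis
  moreover from this have "v \<notin> face_at lam T"
    using assms by (intro exchange_not_in_face[of v a T b]) auto
  ultimately show ?thesis by blast
qed

lemma face_at_proper:
  assumes "S \<noteq> {}" "S \<noteq> UNIV"
  shows "(face_at lam S :: (real, 'm) vec set) \<noteq> rado_polytope lam"
proof -
  obtain a b where "a \<in> S" "b \<notin> S" using assms by blast
  \<comment> \<open>The face of \<open>UNIV\<close> is the whole polytope.\<close>
  then have "\<not> face_at lam UNIV \<subseteq> (face_at lam S :: (real, 'm) vec set)"
    using card_ge_2 nonconstant by (intro exchange_arrangement[of a S b "CARD('m) - 1" 0]) auto
  then show ?thesis by (auto simp: face_at_def)
qed

text \<open>A strictly larger proper face would have a dimension strictly between those of the facet
  and of the polytope, which differ by one.\<close>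

lemma facet_maximal:
  fixes F G :: "(real, 'm) vec set"
  assumes "F facet_of rado_polytope lam" "F \<subseteq> G" "G face_of rado_polytope lam" "G \<noteq> rado_polytope lam"
  shows "F = G"
proof (rule ccontr)
  assume "F \<noteq> G"
  have "F face_of G"
    by (rule face_of_subset[OF facet_of_imp_face_of[OF assms(1)] assms(2) face_of_imp_subset[OF assms(3)]])
  then have "aff_dim F < aff_dim G"
    by (rule face_of_aff_dim_lt[OF face_of_imp_convex[OF assms(3)] _ \<open>F \<noteq> G\<close>])
  moreover have "aff_dim G < aff_dim (rado_polytope lam :: (real, 'm) vec set)"
    by (rule face_of_aff_dim_lt[OF convex_rado_polytope assms(3,4)])
  ultimately show False
    using assms(1) by (simp add: facet_of_def)
qed

text \<open>A facet consists of the maximizers of some functional. Its coefficients are not all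
  equal, since otherwise it would be constant on the polytope; hence the maximizers lie in some
  \<open>face_at lam S\<close>, and maximality gives equality.\<close>

lemma facet_eq_face_at:
  fixes F :: "(real, 'm) vec set"
  assumes F: "F facet_of rado_polytope lam"
  obtains S where "S \<noteq> {}" "S \<noteq> UNIV" "F = face_at lam S"
proof -
  obtain a b where ab: "rado_polytope lam \<subseteq> {x. a \<bullet> x \<le> b}"
      "F = rado_polytope lam \<inter> {x. a \<bullet> x = b}"
    using facet_of_polyhedron[OF polyhedron_rado F] by metis
  obtain v where v: "v \<in> arrangements lam" "\<And>x. x \<in> rado_polytope lam \<Longrightarrow> a \<bullet> x \<le> a \<bullet> v"
    "(\<exists>i j. a $ i \<noteq> a $ j) \<Longrightarrow>
       \<exists>S. S \<noteq> {} \<and> S \<noteq> UNIV \<and> {x \<in> rado_polytope lam. a \<bullet> x = a \<bullet> v} \<subseteq> face_at lam S"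
    using linear_functional_maximum by blast
  have "F \<noteq> {}" using F by (simp add: facet_of_def)
  then obtain y where "y \<in> rado_polytope lam" "a \<bullet> y = b" using ab by auto
  then have b: "b = a \<bullet> v"
    using v(2)[of y] ab(1) v(1) arrangements_subset_rado by fastforce
  have "\<exists>i j. a $ i \<noteq> a $ j"
  proof (rule ccontr)
    assume "\<nexists>i j. a $ i \<noteq> a $ j"
    then obtain t where "\<And>i. a $ i = t" by metis
    then have "a = t *\<^sub>R indicator_vec UNIV"
      by (simp add: vec_eq_iff indicator_vec_def)
    then have "a \<bullet> x = a \<bullet> y" if "x \<in> rado_polytope lam" for x
      using that \<open>y \<in> rado_polytope lam\<close> by (simp add: rado_polytope_iff)
    then have "F = rado_polytope lam"
      using ab \<open>a \<bullet> y = b\<close> by auto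
    then show False using F by simp
  qed
  then obtain S where S: "S \<noteq> {}" "S \<noteq> UNIV" "F \<subseteq> face_at lam S"
    using v(3) ab(2) b by blast
  then have "F = face_at lam S"
    using facet_maximal[OF F _ face_at_face_of face_at_proper] by blast
  then show ?thesis using that S by blast
qed

lemma entry_le_first: "x \<in> rado_polytope lam \<Longrightarrow> (x :: (real, 'm) vec) $ i \<le> lam ! 0"
  using indicator_vec_le_top_sum[of x lam "{i}"] top_sum_Suc[of 0 lam] length_lam
  by (simp add: indicator_vec_inner top_sum_def)

lemma last_le_entry:
  fixes x :: "(real, 'm) vec"
  assumes "x \<in> rado_polytope lam"
  shows "lam ! (CARD('m) - 1) \<le> x $ i"
  using indicator_vec_le_top_sum[OF assms, of "- {i}"] indicator_vec_UNIV_eq_top_sum[OF assms]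
    top_sum_Suc[of "CARD('m) - 1" lam] indicator_vec_Compl[of "{i}" x] length_lam card_ge_2
  by (simp add: indicator_vec_inner card_Compl)

lemma singleton_proper: "{a} \<noteq> (UNIV :: 'm set)" "- {a} \<noteq> ({} :: 'm set)"
proof -
  show 1: "{a} \<noteq> (UNIV :: 'm set)"
    using card_ge_2 by (auto dest: arg_cong[of _ _ card])
  show "- {a} \<noteq> ({} :: 'm set)"
    using 1 by (metis Compl_empty_eq double_complement)
qed

lemma card_proper_subset:
  fixes S :: "'m set"
  assumes "S \<noteq> {}" "S \<noteq> UNIV"
  shows "0 < card S" "card S < CARD('m)"
  using assms by (auto simp: card_gt_0_iff intro!: psubset_card_mono)

text \<open>No dimension count is needed: a facet is maximal among the proper faces, but if the condition
  on \<open>card S\<close> fails, the face lies in several distinct proper faces, one for each element of \<open>S\<close>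
  or of its complement.\<close>

lemma facet_index_of_facet:
  fixes S :: "'m set"
  assumes S: "S \<noteq> {}" "S \<noteq> UNIV" and facet: "face_at lam S facet_of rado_polytope lam"
  shows "facet_index lam (card S)"
proof -
  note k = card_proper_subset[OF S]
  have eq_face: "face_at lam S = face_at lam T"
    if "face_at lam S \<subseteq> face_at lam T" "T \<noteq> {}" "T \<noteq> UNIV" for T
    using facet_maximal[OF facet that(1) face_at_face_of face_at_proper[OF that(2,3)]] .
  have "lam ! (card S - 1) < lam ! 0" if "card S \<noteq> 1"
  proof (rule ccontr)
    assume not_less: "\<not> ?thesis"
    \<comment> \<open>The first \<open>card S\<close> parts are now equal, so attaining the bound
      forces every coordinate in \<open>S\<close> to be maximal.\<close>
    have top: "lam ! i = lam ! 0" if i: "i < card S" for i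
    proof (rule antisym)
      have "lam ! 0 \<le> lam ! (card S - 1)" using not_less by simp
      also have "\<dots> \<le> lam ! i"
        using i k length_lam by (intro nth_decreasing[OF decreasing]) linarith+
      finally show "lam ! 0 \<le> lam ! i" .
      show "lam ! i \<le> lam ! 0"
        using i k length_lam by (intro nth_decreasing[OF decreasing]) linarith+
    qed
    have L: "top_sum lam (card S) = card S * lam ! 0"
      using top_sum_const_block[of 0 "card S" lam "lam ! 0", OF _ _ top] k length_lam
      by (simp add: top_sum_def)
    have "x \<in> face_at lam {a}" if "a \<in> S" "x \<in> face_at lam S" for a and x :: "(real, 'm) vec"
    proof -
      have x: "x \<in> rado_polytope lam" "(\<Sum>i\<in>S. x $ i) = card S * lam ! 0"
        using that(2) L by (auto simp: face_at_def indicator_vec_inner)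
      then have "(\<Sum>i\<in>S. lam ! 0 - x $ i) = 0"
        by (simp add: sum_subtractf)
      then have "lam ! 0 - x $ a = 0"
        using entry_le_first[OF x(1)] that(1) by (subst (asm) sum_nonneg_eq_0_iff) auto
      then show ?thesis
        using x(1) top_sum_Suc[of 0 lam] length_lam
        by (simp add: face_at_def indicator_vec_inner top_sum_def)
    qed
    then have "face_at lam S = face_at lam {a}" if "a \<in> S" for a
      using that singleton_proper[of a] by (intro eq_face) auto
    moreover obtain a b where "a \<in> S" "b \<in> S" "a \<noteq> b"
    proof -
      obtain a where "a \<in> S" using S by auto
      moreover have "S \<noteq> {a}" using \<open>card S \<noteq> 1\<close> by auto
      ultimately show ?thesis using that by blast
    qed
    ultimately have "face_at lam {a} = (face_at lam {b} :: (real, 'm) vec set)"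
      by metis
    moreover have "\<not> face_at lam {a} \<subseteq> (face_at lam {b} :: (real, 'm) vec set)"
      using card_ge_2 nonconstant \<open>a \<noteq> b\<close>
      by (intro exchange_arrangement[of b "{b}" a "CARD('m) - 1" 0]) auto
    ultimately show False by simp
  qed
  moreover have "lam ! (CARD('m) - 1) < lam ! card S" if "card S \<noteq> CARD('m) - 1"
  proof (rule ccontr)
    assume "\<not> ?thesis"
    then have not_less: "\<not> lam ! (CARD('m) - 1) < lam ! card S" .
    \<comment> \<open>The mirror image: the parts after the first \<open>card S\<close> are equal,
      so on the face every coordinate \<open>a\<close> outside \<open>S\<close> is minimal and the
      sum over \<open>- {a}\<close> is maximal.\<close>
    have bot: "lam ! i = lam ! (CARD('m) - 1)" if i: "card S \<le> i" "i < CARD('m)" for i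
    proof (rule antisym)
      have "lam ! i \<le> lam ! card S"
        using i length_lam by (intro nth_decreasing[OF decreasing]) linarith+
      also have "\<dots> \<le> lam ! (CARD('m) - 1)" using not_less by simp
      finally show "lam ! i \<le> lam ! (CARD('m) - 1)" .
      show "lam ! (CARD('m) - 1) \<le> lam ! i"
        using i length_lam by (intro nth_decreasing[OF decreasing]) linarith+
    qed
    have L: "top_sum lam CARD('m) = top_sum lam (card S) + (CARD('m) - card S) * lam ! (CARD('m) - 1)"
      using k length_lam by (intro top_sum_const_block bot) auto
    have "x \<in> face_at lam (- {a})" if "a \<notin> S" "x \<in> face_at lam S" for a and x :: "(real, 'm) vec"
    proof -
      have x: "x \<in> rado_polytope lam" "indicator_vec S \<bullet> x = top_sum lam (card S)"
        using that(2) by (auto simp: face_at_def)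
      then have "indicator_vec (- S) \<bullet> x = card (- S) * lam ! (CARD('m) - 1)"
        using L indicator_vec_UNIV_eq_top_sum[OF x(1)] by (simp add: indicator_vec_Compl card_Compl)
      then have "(\<Sum>i\<in>-S. x $ i - lam ! (CARD('m) - 1)) = 0"
        by (simp add: sum_subtractf indicator_vec_inner)
      then have "x $ a - lam ! (CARD('m) - 1) = 0"
        using last_le_entry[OF x(1)] that(1) by (subst (asm) sum_nonneg_eq_0_iff) auto
      then show ?thesis
        using x(1) top_sum_Suc[of "CARD('m) - 1" lam] length_lam card_ge_2
          indicator_vec_UNIV_eq_top_sum[OF x(1)] indicator_vec_Compl[of "{a}" x]
        by (simp add: face_at_def indicator_vec_inner card_Compl)
    qed
    then have "face_at lam S = face_at lam (- {a})" if "a \<notin> S" for a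
      using that singleton_proper[of a] by (intro eq_face) auto
    moreover obtain a b where "a \<notin> S" "b \<notin> S" "a \<noteq> b"
    proof -
      obtain a where "a \<notin> S" using S by auto
      moreover have "- S \<noteq> {a}" using card_Compl[of S] k \<open>card S \<noteq> CARD('m) - 1\<close> by auto
      ultimately show ?thesis using that by blast
    qed
    ultimately have "face_at lam (- {a}) = (face_at lam (- {b}) :: (real, 'm) vec set)"
      by metis
    moreover have "\<not> face_at lam (- {a}) \<subseteq> (face_at lam (- {b}) :: (real, 'm) vec set)"
      using card_ge_2 nonconstant \<open>a \<noteq> b\<close>
      by (intro exchange_arrangement[of a "- {b}" b "CARD('m) - 1" 0])
        (auto simp: card_Compl)
    ultimately show False by simp
  qed
  ultimately show ?thesis
    using length_lam by (auto simp: facet_index_def)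
qed

text \<open>Some facet \<open>face_at lam T\<close> contains the face, and exchanges show
  \<open>T = S\<close>: the two conditions of \<open>facet_index\<close> provide unequal parts among
  the first \<open>card S\<close> positions and among the others, whenever there are at least two of
  them.\<close>

lemma facet_of_facet_index:
  fixes S :: "'m set"
  assumes S: "S \<noteq> {}" "S \<noteq> UNIV" and idx: "facet_index lam (card S)"
  shows "face_at lam S facet_of rado_polytope lam"
proof -
  note k = card_proper_subset[OF S]
  obtain F where F: "F facet_of rado_polytope lam" "face_at lam S \<subseteq> F"
    using face_of_polyhedron_subset_facet[OF polyhedron_rado face_at_face_of face_at_nonempty face_at_proper[OF S]] .
  obtain T where T: "T \<noteq> {}" "T \<noteq> UNIV" "F = face_at lam T"
    using facet_eq_face_at[OF F(1)] .
  then have sub: "face_at lam S \<subseteq> (face_at lam T :: (real, 'm) vec set)"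
    using F by simp
  have 1: "\<not> (a \<in> S \<inter> T \<and> b \<in> S - T)" for a b
  proof
    assume ab: "a \<in> S \<inter> T \<and> b \<in> S - T"
    then have "card {a, b} \<le> card S" by (intro card_mono) auto
    moreover have "a \<noteq> b" using ab by auto
    ultimately have "2 \<le> card S" by simp
    moreover from this have "card S - 1 < CARD('m)" using k by linarith
    ultimately show False
      using exchange_arrangement[of a T b "card S - 1" 0 S] sub ab idx k
      by (auto simp: facet_index_def)
  qed
  have 2: "\<not> (a \<in> T - S \<and> b \<notin> T \<union> S)" for a b
  proof
    assume ab: "a \<in> T - S \<and> b \<notin> T \<union> S"
    then have "card {a, b} \<le> card (- S)" by (intro card_mono) auto
    moreover have "a \<noteq> b" using ab by auto
    ultimately have "2 \<le> card (- S)" by simp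
    moreover have "\<not> CARD('m) - 1 < card S" using k by linarith
    ultimately show False
      using exchange_arrangement[of a T b "CARD('m) - 1" "card S" S] sub ab idx k length_lam
      by (auto simp: facet_index_def card_Compl)
  qed
  have "\<not> CARD('m) - 1 < card S" using k by linarith
  then have 3: "\<not> (a \<in> T - S \<and> b \<in> S - T)" for a b
    using exchange_arrangement[of a T b "CARD('m) - 1" 0 S] sub k nonconstant by auto
  \<comment> \<open>By \<open>1\<close>, \<open>S\<close> lies in \<open>T\<close> or is disjoint
    from it; \<open>3\<close> excludes disjointness, and \<open>2\<close> excludes further elements
    of \<open>T\<close>.\<close>
  have "S = T"
    using 1 2 3 S T(1,2) by blast
  then show ?thesis using F T by simp
qed

section \<open>Lattice distance from the facets\<close>

lemma lattice_point_inner: "lattice_point (q :: (real, 'm) vec) \<Longrightarrow> indicator_vec S \<bullet> q \<in> \<int>"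
  by (auto simp: indicator_vec_inner lattice_point_def)

text \<open>Lattice points have integer values under \<open>indicator_vec S\<close>, so a gap of
  \<open>1\<close> between \<open>p\<close> and the facet leaves none of them in the slab. A gap of
  at least \<open>2\<close> leaves room for a lattice point of the affine hull with value one below
  the maximum.\<close>

lemma lattice_distance_one_iff:
  fixes S :: "'m set"
  assumes S: "S \<noteq> {}" "S \<noteq> UNIV" and facet: "face_at lam S facet_of rado_polytope lam"
    and p: "lattice_point p" "p \<in> rel_interior (rado_polytope lam)"
  shows "lattice_distance_one p (face_at lam S) \<longleftrightarrow> indicator_vec S \<bullet> p = real (top_sum lam (card S)) - 1"
proof
  let ?f = "indicator_vec S" and ?L = "real (top_sum lam (card S))" and ?F = "face_at lam S"
  have "?F \<inter> rel_interior (rado_polytope lam) = {}"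
    using face_at_face_of face_at_proper[OF S] by (rule face_of_disjoint_rel_interior)
  moreover have pP: "p \<in> rado_polytope lam"
    using p(2) rel_interior_subset by blast
  ultimately have p_less: "?f \<bullet> p < ?L"
    using p(2) indicator_vec_le_top_sum[of p lam S] by (force simp: face_at_def)
  have aff: "affine hull ?F \<subseteq> {x. ?f \<bullet> x = ?L}"
    by (rule hull_minimal) (auto simp: face_at_def affine_hyperplane)
  {
    assume dist: "lattice_distance_one p ?F"
    show "?f \<bullet> p = ?L - 1"
    proof (rule ccontr)
      assume ne: "?f \<bullet> p \<noteq> ?L - 1"
      define g where "g = ?L - ?f \<bullet> p"
      have "g \<in> \<int>" unfolding g_def using lattice_point_inner[OF p(1)] by auto
      then obtain z where "g = of_int z" by (elim Ints_cases)
      moreover have "0 < g" "g \<noteq> 1" using p_less ne by (auto simp: g_def)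
      ultimately have "z \<ge> 2" by auto
      then have "g \<ge> 2" using \<open>g = of_int z\<close> by simp
      \<comment> \<open>With gap \<open>d + 1\<close>, the point \<open>q\<close> below will divide
        a segment from the facet hyperplane to \<open>p\<close> in the ratio
        \<open>1 : d\<close>.\<close>
      define d where "d = g - 1"
      have d: "d > 0" "?f \<bullet> p = ?L - (d + 1)"
        using \<open>g \<ge> 2\<close> by (simp_all add: d_def g_def)
      obtain a b where ab: "a \<in> S" "b \<notin> S" using S by blast
      then have "a \<noteq> b" by auto
      have pos: "0 \<noteq> CARD('m) - 1" "CARD('m) - 1 < CARD('m)" "0 < CARD('m)"
          "0 < card S \<longleftrightarrow> a \<in> S" "CARD('m) - 1 < card S \<longleftrightarrow> b \<in> S"
        using ab card_ge_2 card_proper_subset[OF S] by auto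
      obtain v :: "(real, 'm) vec" where v: "v \<in> arrangements lam" "v \<in> ?F"
          "v $ a = lam ! 0" "v $ b = lam ! (CARD('m) - 1)"
        using arrangement_with_two_entries[OF \<open>a \<noteq> b\<close> pos(1) pos(3) pos(2) pos(4,5)] .
      define s where "s = v $ a - v $ b"
      have "s > 0" using v nonconstant by (simp add: s_def)
      \<comment> \<open>Moving one unit from \<open>a\<close> to \<open>b\<close> lowers the value
        by \<open>1\<close> and stays in the lattice. Since \<open>s > 0\<close>, the result is on
        the line through \<open>v\<close> and its exchange, hence in the affine hull.\<close>
      define q where "q = v - (axis a 1 - axis b 1)"
      have q_lattice: "lattice_point q"
        using v(1) by (auto simp: lattice_point_def q_def arrangements_def axis_def)
      have fq: "?f \<bullet> q = ?L - 1"
        using v(2) indicator_vec_axis_diff[OF ab] by (simp add: q_def inner_diff_right face_at_def)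
      have affP: "affine hull (rado_polytope lam :: (real, 'm) vec set) \<supseteq> rado_polytope lam"
        by (rule hull_subset)
      have "q = (1 - 1 / s) *\<^sub>R v + (1 / s) *\<^sub>R (v + (v $ b - v $ a) *\<^sub>R (axis a 1 - axis b 1))"
      proof -
        have "(1 / s) *\<^sub>R (v $ b - v $ a) *\<^sub>R (axis a 1 - axis b 1 :: (real, 'm) vec) =
            ((v $ b - v $ a) / s) *\<^sub>R (axis a 1 - axis b 1)"
          by simp
        also have "(v $ b - v $ a) / s = - 1"
          using \<open>s > 0\<close> by (simp add: s_def field_simps)
        finally show ?thesis
          by (simp add: q_def scaleR_add_right algebra_simps)
      qed
      moreover have "v \<in> affine hull rado_polytope lam"
          "v + (v $ b - v $ a) *\<^sub>R (axis a 1 - axis b 1) \<in> affine hull rado_polytope lam"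
        using arrangement_transpose[OF v(1)] v(1) arrangements_subset_rado affP by blast+
      ultimately have q_aff: "q \<in> affine hull rado_polytope lam"
        using mem_affine[OF affine_affine_hull] by fastforce
      \<comment> \<open>The point at which the line from \<open>p\<close> through \<open>q\<close>
        meets the hyperplane of the facet.\<close>
      define h where "h = ((d + 1) / d) *\<^sub>R q + (- 1 / d) *\<^sub>R p"
      have "(d + 1) / d + - 1 / d = 1"
        using d(1) by (simp add: field_simps)
      then have h_aff: "h \<in> affine hull rado_polytope lam"
        unfolding h_def using q_aff pP affP by (intro mem_affine) auto
      have "?f \<bullet> h = (d + 1) / d * (?L - 1) - (?L - (d + 1)) / d"
        by (simp add: h_def inner_diff_right fq d(2))
      also have "\<dots> = ?L"
        using d(1) by (simp add: field_simps)
      finally have fh: "?f \<bullet> h = ?L" .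
      \<comment> \<open>The affine hull of the facet has codimension one and lies in this proper
        affine subspace, so by dimension it is all of it.\<close>
      let ?A = "affine hull rado_polytope lam \<inter> {x. ?f \<bullet> x = ?L}"
      have affA: "affine ?A"
        by (intro affine_Int affine_affine_hull affine_hyperplane)
      have "p \<notin> ?A" "p \<in> affine hull rado_polytope lam"
        using pP affP p_less by auto
      then have "?A \<subset> affine hull rado_polytope lam"
        by blast
      then have "aff_dim ?A < aff_dim (rado_polytope lam :: (real, 'm) vec set)"
        using aff_dim_psubset[of ?A "rado_polytope lam"] affA by (metis affine_hull_eq)
      moreover have F_sub: "affine hull ?F \<subseteq> ?A"
        using aff hull_mono[of ?F "rado_polytope lam" affine] by (auto simp: face_at_def)
      then have "aff_dim ?F \<le> aff_dim ?A"
        by (metis aff_dim_affine_hull aff_dim_subset)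
      ultimately have "aff_dim (affine hull ?F) = aff_dim ?A"
        using facet by (simp add: facet_of_def)
      then have "affine hull ?F = ?A"
        using affA F_sub v(2) by (intro affine_dim_equal) auto
      then have h: "h \<in> affine hull ?F"
        using h_aff fh by simp
      have "q = (1 - 1 / (d + 1)) *\<^sub>R h + (1 / (d + 1)) *\<^sub>R p"
      proof -
        have "(1 - 1 / (d + 1)) * ((d + 1) / d) = 1"
            "(1 - 1 / (d + 1)) * (- 1 / d) = - (1 / (d + 1))"
          using d(1) by (simp_all add: divide_simps)
        then show ?thesis
          by (simp only: h_def scaleR_add_right scaleR_scaleR) simp
      qed
      moreover have "h \<noteq> p" using fh p_less by auto
      ultimately have "q \<in> open_segment h p"
        using d(1) by (auto simp: in_segment intro!: exI[of _ "1 / (d + 1)"])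
      moreover have "p \<in> parallel_through p (affine hull ?F)"
        using h by (force simp: parallel_through_def)
      ultimately have "q \<in> strictly_between (affine hull ?F) (parallel_through p (affine hull ?F))"
        using h by (auto simp: strictly_between_def)
      then show False
        using dist q_lattice by (auto simp: lattice_distance_one_def)
    qed
  }
  {
    assume fp: "?f \<bullet> p = ?L - 1"
    show "lattice_distance_one p ?F"
      unfolding lattice_distance_one_def
    proof (intro ballI notI)
      fix q assume "q \<in> strictly_between (affine hull ?F) (parallel_through p (affine hull ?F))"
        and q: "lattice_point q"
      then obtain h x y where h: "h \<in> affine hull ?F" "x \<in> affine hull ?F" "y \<in> affine hull ?F"
          "q \<in> open_segment h (p + (x - y))"
        by (auto simp: strictly_between_def parallel_through_def)
      then obtain u where u: "0 < u" "u < 1" "q = (1 - u) *\<^sub>R h + u *\<^sub>R (p + (x - y))"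
        by (auto simp: in_segment)
      have fh: "?f \<bullet> h = ?L" "?f \<bullet> x = ?L" "?f \<bullet> y = ?L"
        using h aff by auto
      have "?f \<bullet> q = (1 - u) * ?L + u * (?L - 1 + (?L - ?L))"
        by (simp only: u(3) inner_add_right inner_scaleR_right inner_diff_right fh fp)
      also have "\<dots> = ?L - u"
        by (simp add: algebra_simps)
      finally have "?f \<bullet> q = ?L - u" .
      \<comment> \<open>The segment parameter would be an integer strictly between \<open>0\<close>
        and \<open>1\<close>.\<close>
      then have "u = ?L - ?f \<bullet> q" by simp
      then have "u \<in> \<int>" using lattice_point_inner[OF q] by auto
      then show False using u(1,2) by (auto elim!: Ints_cases)
    qed
  }
qed

section \<open>The numerical criterion for reflexivity\<close>

lemma mean_times_le_top_sum:
  assumes "int (top_sum lam CARD('m)) = int CARD('m) * c" "k \<le> CARD('m)"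
  shows "int k * c \<le> int (top_sum lam k)"
\<comment> \<open>\<open>c\<close> is the mean of the parts. If the part after the first
  \<open>k\<close> is at least \<open>c\<close>, so are the first \<open>k\<close>; otherwise the
  remaining parts are at most \<open>c\<close>, and the first \<open>k\<close> make up for
  them.\<close>
proof (cases "k = CARD('m) \<or> c \<le> int (lam ! k)")
  case True
  then show ?thesis
  proof
    assume c: "c \<le> int (lam ! k)"
    have "c \<le> int (lam ! i)" if "i < k" "k < CARD('m)" for i
      using nth_decreasing[OF decreasing, of i k] that c length_lam by simp
    then have "int k * c \<le> (\<Sum>i<k. int (lam ! i))" if "k < CARD('m)"
      using sum_bounded_below[of "{..<k}" c "\<lambda>i. int (lam ! i)"] that by simp
    then show ?thesis
      using assms by (cases "k = CARD('m)") (auto simp: top_sum_eq_sum_nth length_lam)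
  qed (use assms in simp)
next
  case False
  then have k: "k < CARD('m)" "int (lam ! k) \<le> c" using assms by auto
  have "int (lam ! i) \<le> c" if "i \<in> {k..<CARD('m)}" for i
    using nth_decreasing[OF decreasing, of k i] that k length_lam by simp
  then have "(\<Sum>i\<in>{k..<CARD('m)}. int (lam ! i)) \<le> int (CARD('m) - k) * c"
    using sum_bounded_above[of "{k..<CARD('m)}" "\<lambda>i. int (lam ! i)" c] by simp
  moreover have "(\<Sum>i<CARD('m). int (lam ! i)) = (\<Sum>i<k. int (lam ! i)) + (\<Sum>i\<in>{k..<CARD('m)}. int (lam ! i))"
    using k sum.atLeastLessThan_concat[of 0 k "CARD('m)" "\<lambda>i. int (lam ! i)"]
    by (simp add: atLeast0LessThan)
  ultimately show ?thesis
    using assms k by (simp add: top_sum_eq_sum_nth length_lam of_nat_diff algebra_simps)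
qed

lemma reflexive_rado_iff_nonconstant:
  "reflexive (rado_polytope lam :: (real, 'm) vec set) \<longleftrightarrow>
     (\<exists>c. int (top_sum lam CARD('m)) = int CARD('m) * c \<and>
       (\<forall>k. 0 < k \<and> k < CARD('m) \<and> facet_index lam k \<longrightarrow> int (top_sum lam k) = int k * c + 1))"
    (is "_ \<longleftrightarrow> (\<exists>c. ?crit c)")
proof
  assume "reflexive (rado_polytope lam :: (real, 'm) vec set)"
  then obtain p :: "(real, 'm) vec" where p: "lattice_point p" "p \<in> rel_interior (rado_polytope lam)"
      "\<And>F. F facet_of rado_polytope lam \<Longrightarrow> lattice_distance_one p F"
    by (auto simp: reflexive_def)
  have fp: "indicator_vec S \<bullet> p = real (top_sum lam (card S)) - 1"
    if "S \<noteq> {}" "S \<noteq> UNIV" "facet_index lam (card S)" for S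
    using facet_of_facet_index[OF that] lattice_distance_one_iff[OF that(1,2) _ p(1,2)] p(3) by blast
  \<comment> \<open>A facet exists because \<open>face_at lam {a}\<close> is a nonempty proper face;
    its index is the set size with which \<open>p\<close> is shown to be constant.\<close>
  obtain k where k: "0 < k" "k < CARD('m)" "facet_index lam k"
  proof -
    fix a :: 'm
    obtain F where F: "F facet_of (rado_polytope lam :: (real, 'm) vec set)"
      using face_of_polyhedron_subset_facet[OF polyhedron_rado face_at_face_of face_at_nonempty
        face_at_proper[OF insert_not_empty singleton_proper(1)]] .
    obtain T where T: "T \<noteq> {}" "T \<noteq> UNIV" "F = face_at lam T"
      using facet_eq_face_at[OF F] .
    then show ?thesis
      using that card_proper_subset[OF T(1,2)] facet_index_of_facet[OF T(1,2)] F by blast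
  qed
  have const: "p $ i = p $ j" for i j
  proof (cases "i = j")
    case False
    have "k - 1 \<le> card (UNIV - {i, j})"
      using k False by (simp add: card_Diff_subset)
    \<comment> \<open>Adding \<open>i\<close> or \<open>j\<close> to \<open>R\<close> gives two sets
      of size \<open>k\<close>, over which \<open>p\<close> has the same sum.\<close>
    then obtain R where R: "R \<subseteq> UNIV - {i, j}" "card R = k - 1"
      by (meson obtain_subset_with_card_n)
    have "p $ l + (\<Sum>i\<in>R. p $ i) = real (top_sum lam k) - 1" if "l \<in> {i, j}" for l
    proof -
      have "l \<notin> R" using R that by auto
      then have "card (insert l R) = k" using R k by simp
      moreover from this have "insert l R \<noteq> UNIV" using k by auto
      ultimately show ?thesis
        using fp[of "insert l R"] k \<open>l \<notin> R\<close> by (simp add: indicator_vec_inner)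
    qed
    from this[of i] this[of j] show ?thesis by simp
  qed simp
  obtain c where c: "\<And>i. p $ i = of_int c"
  proof -
    fix i :: 'm
    have "p $ i \<in> \<int>" using p(1) by (simp add: lattice_point_def)
    then show ?thesis using that const by (metis Ints_cases)
  qed
  have f_const: "indicator_vec S \<bullet> p = of_int (int (card S) * c)" for S
    by (simp add: indicator_vec_inner c)
  have "p \<in> rado_polytope lam" using p(2) rel_interior_subset by blast
  then have "real_of_int (int CARD('m) * c) = of_int (int (top_sum lam CARD('m)))"
    using indicator_vec_UNIV_eq_top_sum[of p lam] f_const[of UNIV] by simp
  moreover have "int (top_sum lam l) = int l * c + 1"
    if l: "0 < l" "l < CARD('m)" "facet_index lam l" for l
  proof -
    obtain S :: "'m set" where S: "card S = l"
      using l by (meson less_imp_le obtain_subset_with_card_n)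
    then have "S \<noteq> {}" "S \<noteq> UNIV" using l by auto
    then have "real_of_int (int l * c) = of_int (int (top_sum lam l) - 1)"
      using fp[of S] f_const[of S] S l(3) by simp
    then show ?thesis by (simp only: of_int_eq_iff)
  qed
  ultimately have "?crit c" by (simp only: of_int_eq_iff) auto
  then show "\<exists>c. ?crit c" ..
next
  assume "\<exists>c. ?crit c"
  then obtain c where c: "int (top_sum lam CARD('m)) = int CARD('m) * c"
      "\<And>k. \<lbrakk>0 < k; k < CARD('m); facet_index lam k\<rbrakk> \<Longrightarrow> int (top_sum lam k) = int k * c + 1"
    by auto
  define p :: "(real, 'm) vec" where "p = (\<chi> i. of_int c)"
  have f_p: "indicator_vec S \<bullet> p = of_int (int (card S) * c)" for S
    by (simp add: indicator_vec_inner p_def)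
  have "indicator_vec S \<bullet> p \<le> of_int (int (top_sum lam (card S)))" for S
    unfolding f_p of_int_le_iff by (rule mean_times_le_top_sum[OF c(1)]) (simp add: card_mono)
  moreover have "indicator_vec UNIV \<bullet> p = real (top_sum lam CARD('m))"
    using arg_cong[OF c(1), of real_of_int] by (simp add: f_p)
  ultimately have pP: "p \<in> rado_polytope lam"
    by (simp add: rado_polytope_iff)
  have facet: "indicator_vec S \<bullet> p = real (top_sum lam (card S)) - 1"
    if "S \<noteq> {}" "S \<noteq> UNIV" "face_at lam S facet_of rado_polytope lam" for S
    using arg_cong[OF c(2)[OF card_proper_subset[OF that(1,2)] facet_index_of_facet[OF that]],
        of real_of_int]
    by (simp add: f_p)
  \<comment> \<open>The relative interior of a polyhedron is what remains after removing its
    facets.\<close>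
  have "p \<notin> F" if F: "F facet_of rado_polytope lam" for F
  proof -
    obtain S where "S \<noteq> {}" "S \<noteq> UNIV" "F = face_at lam S"
      using facet_eq_face_at[OF F] .
    then show ?thesis using facet[of S] F by (auto simp: face_at_def)
  qed
  then have p_int: "p \<in> rel_interior (rado_polytope lam)"
    using pP by (simp add: rel_interior_of_polyhedron[OF polyhedron_rado])
  have p_lattice: "lattice_point p"
    by (simp add: lattice_point_def p_def)
  have "lattice_distance_one p F" if F: "F facet_of rado_polytope lam" for F
  proof -
    obtain S where S: "S \<noteq> {}" "S \<noteq> UNIV" "F = face_at lam S"
      using facet_eq_face_at[OF F] .
    then show ?thesis
      using lattice_distance_one_iff[OF S(1,2) _ p_lattice p_int] facet[of S] F by simp
  qed
  \<comment> \<open>A nonempty proper face has dimension at least \<open>0\<close> and less than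
    that of the polytope.\<close>
  moreover have "0 < aff_dim (rado_polytope lam :: (real, 'm) vec set)"
  proof -
    fix a :: 'm
    have "aff_dim (face_at lam {a} :: (real, 'm) vec set) < aff_dim (rado_polytope lam :: (real, 'm) vec set)"
      using face_of_aff_dim_lt[OF convex_rado_polytope face_at_face_of face_at_proper[OF insert_not_empty singleton_proper(1)]] .
    moreover have "0 \<le> aff_dim (face_at lam {a} :: (real, 'm) vec set)"
      using face_at_nonempty[of "{a}"] aff_dim_geq[of "face_at lam {a} :: (real, 'm) vec set"]
        aff_dim_empty[of "face_at lam {a} :: (real, 'm) vec set"] by linarith
    ultimately show ?thesis by simp
  qed
  ultimately show "reflexive (rado_polytope lam :: (real, 'm) vec set)"
    using lattice_polytope_rado p_int p_lattice by (auto simp: reflexive_def)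
qed

end

text \<open>In the constant case all arrangements coincide, so the polytope is a point and fails the
  condition of positive dimension.\<close>

lemma reflexive_Newt_schur_polynomial_iff:
  "reflexive (Newt (schur_polynomial lam :: ('m \<Rightarrow>\<^sub>0 nat) \<Rightarrow>\<^sub>0 int)) \<longleftrightarrow>
     lam ! (CARD('m) - 1) < lam ! 0 \<and>
     (\<exists>c. int (top_sum lam CARD('m)) = int CARD('m) * c \<and>
       (\<forall>k. 0 < k \<and> k < CARD('m) \<and> facet_index lam k \<longrightarrow> int (top_sum lam k) = int k * c + 1))"
proof (cases "lam ! (CARD('m) - 1) < lam ! 0")
  case True
  then show ?thesis
    by (simp add: Newt_schur_polynomial reflexive_rado_iff_nonconstant)
next
  case False
  have const: "lam ! i = lam ! 0" if "i < CARD('m)" for i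
  proof -
    have "i \<le> CARD('m) - 1" using that by linarith
    then show ?thesis
      using False that nth_decreasing[OF decreasing, of i "CARD('m) - 1"]
        nth_decreasing[OF decreasing, of 0 i] length_lam by simp
  qed
  have "arrangements lam \<subseteq> {\<chi> i :: 'm. real (lam ! 0)}"
  proof
    fix v :: "(real, 'm) vec" assume "v \<in> arrangements lam"
    then obtain w where w: "bij_betw w UNIV {..<CARD('m)}" "v = (\<chi> i. real (lam ! w i))"
      by (auto simp: arrangements_def)
    have "w i < CARD('m)" for i
      using w(1) by (auto simp: bij_betw_def)
    then show "v \<in> {\<chi> i :: 'm. real (lam ! 0)}"
      using const[of "w _"] by (simp add: w(2) vec_eq_iff)
  qed
  then have "aff_dim (arrangements lam :: (real, 'm) vec set) \<le> 0"
    by (metis aff_dim_sing aff_dim_subset)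
  then have "\<not> reflexive (rado_polytope lam :: (real, 'm) vec set)"
    by (simp add: reflexive_def rado_polytope_eq_convex_hull aff_dim_convex_hull)
  then show ?thesis
    using False by (simp add: Newt_schur_polynomial)
qed

end

section \<open>Partitions meeting the facet condition\<close>

text \<open>The reflexivity criterion as a property of the list alone. With \<open>c\<close> an
  integer, the shift by \<open>d\<close> in the translation rule cannot truncate.\<close>

definition unit_excess :: "nat list \<Rightarrow> int \<Rightarrow> bool" where
  "unit_excess lam c \<longleftrightarrow> int (top_sum lam (length lam)) = int (length lam) * c \<and>
     (\<forall>k. 0 < k \<and> k < length lam \<and> facet_index lam k \<longrightarrow> int (top_sum lam k) = int k * c + 1)"

text \<open>Adding \<open>d\<close> to all parts adds \<open>k * d\<close> to the sum of the first
  \<open>k\<close> and preserves comparisons of parts, so only the mean changes.\<close>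

lemma unit_excess_translate:
  "unit_excess (map (\<lambda>k. k + d) mu) c \<longleftrightarrow> unit_excess mu (c - int d)"
proof -
  have top: "top_sum (map (\<lambda>k. k + d) mu) k = top_sum mu k + k * d" if "k \<le> length mu" for k
    using that by (simp add: top_sum_def take_map sum_list_addf sum_list_triv)
  have "facet_index (map (\<lambda>k. k + d) mu) k \<longleftrightarrow> facet_index mu k" if "0 < k" "k < length mu" for k
  proof -
    have "k - 1 < length mu" "length mu - 1 < length mu" "0 < length mu" using that by linarith+
    then show ?thesis using that by (simp add: facet_index_def)
  qed
  then show ?thesis
    by (auto simp: unit_excess_def top algebra_simps)
qed

lemma decreasing_le_2_decomposition:
  assumes "sorted_wrt (\<ge>) (xs :: nat list)" "\<forall>x\<in>set xs. x \<le> 2"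
  shows "\<exists>a e b. xs = replicate a 2 @ replicate e 1 @ replicate b 0"
  using assms
proof (induction xs)
  case Nil
  show ?case by (intro exI[of _ 0]) simp
next
  case (Cons x xs)
  then obtain a e b where xs: "xs = replicate a 2 @ replicate e 1 @ replicate b 0"
    by auto
  have le: "\<forall>y\<in>set xs. y \<le> x" using Cons.prems(1) by simp
  have "0 < a \<Longrightarrow> 2 \<in> set xs" "0 < e \<Longrightarrow> 1 \<in> set xs"
    by (simp_all add: xs)
  then have a: "0 < a \<Longrightarrow> 2 \<le> x" and e: "0 < e \<Longrightarrow> 1 \<le> x"
    using le by blast+
  consider "x = 0" | "x = 1" | "x = 2" using Cons.prems(2) by force
  then show ?case
  proof cases
    case 1
    then have "a = 0" "e = 0" using a e by linarith+
    then show ?thesis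
      using 1 xs by (intro exI[of _ 0] exI[of _ "Suc b"]) simp
  next
    case 2
    then have "a = 0" using a by linarith
    then show ?thesis
      using 2 xs by (intro exI[of _ 0] exI[of _ "Suc e"] exI[of _ b]) simp
  next
    case 3
    then show ?thesis
      using xs by (intro exI[of _ "Suc a"] exI[of _ e] exI[of _ b]) simp
  qed
qed

lemma unit_excess_imp_shape:
  fixes mu :: "nat list"
  defines "m \<equiv> length mu"
  assumes m: "m \<ge> 2" and dec: "sorted_wrt (\<ge>) mu" and last: "mu ! (m - 1) = 0"
    and pos: "0 < mu ! 0" and c: "unit_excess mu c"
  shows "mu = m # replicate (m - 1) 0
    \<or> mu = 2 # replicate (m - 2) 1 @ [0]
    \<or> (even m \<and> mu = replicate (m div 2) 2 @ replicate (m div 2) 0)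
    \<or> (odd m \<and> mu = replicate ((m - 1) div 2) 2 @ [1] @ replicate ((m - 1) div 2) 0)
    \<or> mu = replicate (m - 1) m @ [0]"
proof -
  have total: "int (top_sum mu m) = int m * c"
    and facet: "\<And>k. 0 < k \<Longrightarrow> k < m \<Longrightarrow> facet_index mu k \<Longrightarrow> int (top_sum mu k) = int k * c + 1"
    using c by (auto simp: unit_excess_def m_def)
  have top_1: "top_sum mu 1 = mu ! 0"
    using m by (cases mu) (auto simp: top_sum_def m_def)
  \<comment> \<open>The last part is \<open>0\<close>, so the first \<open>m - 1\<close> parts also
    sum to \<open>m * c\<close>; if \<open>m - 1\<close> is a facet index, this forces
    \<open>c = 1\<close>.\<close>
  have total': "top_sum mu m = top_sum mu (m - 1)"
  proof -
    have "m - 1 < length mu" "Suc (m - 1) = m" using m unfolding m_def by linarith+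
    then show ?thesis using top_sum_Suc[of "m - 1" mu] last by simp
  qed
  have anti: "mu ! j \<le> mu ! i" if "i \<le> j" "j < m" for i j
    using nth_decreasing[OF dec that(1)] that by (simp add: m_def)
  \<comment> \<open>The facet index exploited is \<open>m - 1\<close> in the first case and
    \<open>1\<close> in the second; the third uses both.\<close>
  consider "mu ! 1 = 0" | "mu ! (m - 2) = mu ! 0" | "0 < mu ! 1" "mu ! (m - 2) < mu ! 0"
    using anti[of 0 "m - 2"] m by linarith
  then show ?thesis
  proof cases
    case 1
    then have zero: "mu ! i = 0" if "1 \<le> i" "i < m" for i
      using anti[OF that] by simp
    have "m - 1 = 1 \<or> mu ! (m - 1 - 1) < mu ! 0"
    proof (cases "m = 2")
      case False
      then have "mu ! (m - 1 - 1) = 0" using m by (intro zero) linarith+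
      then show ?thesis using pos by simp
    qed simp
    then have "facet_index mu (m - 1)"
      by (simp add: facet_index_def m_def)
    then have "int (top_sum mu (m - 1)) = int (m - 1) * c + 1"
      using m by (intro facet) auto
    then have "c = 1"
      using total total' m by (simp add: of_nat_diff algebra_simps)
    moreover have "top_sum mu m = mu ! 0"
      using top_sum_const_block[of 1 m mu 0, OF _ _ zero] m top_1 by (simp add: m_def)
    ultimately have "mu ! 0 = m"
      using total by simp
    then have "mu = m # replicate (m - 1) 0"
      using zero m by (intro nth_equalityI) (auto simp: m_def nth_Cons split: nat.split)
    then show ?thesis by blast
  next
    case 2
    have const: "mu ! i = mu ! 0" if "i < m - 1" for i
    proof (rule antisym)
      have "i \<le> m - 2" "m - 2 < m" using that m by linarith+
      then show "mu ! 0 \<le> mu ! i" using anti[of i "m - 2"] 2 by simp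
      show "mu ! i \<le> mu ! 0" using that by (intro anti) linarith+
    qed
    have "1 = m - 1 \<or> mu ! (m - 1) < mu ! 1"
      using const[of 1] m pos last by (cases "m = 2") auto
    then have "facet_index mu 1"
      by (simp add: facet_index_def m_def)
    then have t: "int (mu ! 0) = c + 1"
      using facet[of 1] m top_1 by simp
    have "top_sum mu (m - 1) = (m - 1) * mu ! 0"
      using top_sum_const_block[of 0 "m - 1" mu "mu ! 0", OF _ _ const] m
      by (simp add: m_def top_sum_def)
    then have "int (m - 1) * (c + 1) = int m * c"
      using total total' t by simp
    then have "c = int m - 1"
      using m by (simp add: of_nat_diff algebra_simps)
    then have "mu ! 0 = m" using t by simp
    then have "mu = replicate (m - 1) m @ [0]"
    proof (intro nth_equalityI)
      fix i assume "i < length mu"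
      then have "i < m - 1 \<or> i = m - 1" unfolding m_def by linarith
      then show "mu ! i = (replicate (m - 1) m @ [0]) ! i"
        using const[of i] last \<open>mu ! 0 = m\<close> by (auto simp: nth_append)
    qed (use m in \<open>simp add: m_def\<close>)
    then show ?thesis by blast
  next
    case 3
    have "facet_index mu 1" "facet_index mu (m - 1)"
      using 3 last by (simp_all add: facet_index_def m_def numeral_2_eq_2)
    then have "int (mu ! 0) = c + 1" "int (top_sum mu (m - 1)) = int (m - 1) * c + 1"
      using facet[of 1] facet[of "m - 1"] m top_1 by simp_all
    then have "c = 1" "mu ! 0 = 2"
      using total total' m by (simp_all add: of_nat_diff algebra_simps)
    then have total_m: "top_sum mu m = m" using total by simp
    have "\<forall>x\<in>set mu. x \<le> 2"
      using anti[of 0] \<open>mu ! 0 = 2\<close> by (auto simp: in_set_conv_nth m_def)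
    then obtain a e b where mu: "mu = replicate a 2 @ replicate e 1 @ replicate b 0"
      using decreasing_le_2_decomposition[OF dec] by blast
    have len: "a + e + b = m" by (simp add: m_def mu)
    \<comment> \<open>Mean \<open>1\<close> makes the sum equal to the length, so there are as many
      twos as zeros.\<close>
    have "2 * a + e = m"
      using total_m by (simp add: top_sum_def m_def mu sum_list_replicate)
    then have "b = a" using len by simp
    have "a > 0"
      using \<open>mu ! 0 = 2\<close> mu m len \<open>b = a\<close> by (cases a; cases e) auto
    consider "e = 0" | "e = 1" | "e \<ge> 2" by linarith
    then show ?thesis
    proof cases
      case 1
      then show ?thesis using mu len \<open>b = a\<close> by auto
    next
      case 2
      then show ?thesis using mu len \<open>b = a\<close> by auto
    next
      case 3
      \<comment> \<open>The cut after the first of several ones satisfies both strict inequalities.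
        Its sum \<open>2 * a + 1\<close> must then be \<open>a + 2\<close>, which leaves a single
        two.\<close>
      have "mu ! a = 1" "mu ! (a + 1) = 1"
        using 3 by (simp_all add: mu nth_append)
      then have "facet_index mu (a + 1)"
        using \<open>mu ! 0 = 2\<close> last by (simp add: facet_index_def m_def)
      then have "int (top_sum mu (a + 1)) = int (a + 1) + 1"
        using facet[of "a + 1"] \<open>c = 1\<close> len 3 \<open>a > 0\<close> \<open>b = a\<close> by simp
      moreover have "top_sum mu (a + 1) = 2 * a + 1"
        using 3 by (simp add: mu top_sum_def sum_list_replicate min_def)
      ultimately have "a = 1" by simp
      then show ?thesis
        using mu len \<open>b = a\<close> by auto
    qed
  qed
qed

text \<open>The witness \<open>c\<close> is the mean of the parts: \<open>1\<close> for the first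
  four shapes and \<open>m - 1\<close> for the last.\<close>

lemma unit_excess_of_shape:
  assumes m: "m \<ge> 2" and shape: "mu = m # replicate (m - 1) 0
    \<or> mu = 2 # replicate (m - 2) 1 @ [0]
    \<or> (even m \<and> mu = replicate (m div 2) 2 @ replicate (m div 2) 0)
    \<or> (odd m \<and> mu = replicate ((m - 1) div 2) 2 @ [1] @ replicate ((m - 1) div 2) 0)
    \<or> mu = replicate (m - 1) m @ [0]"
  shows "0 < mu ! 0 \<and> (\<exists>c. unit_excess mu c)"
  using shape
proof (elim disjE conjE)
  assume mu: "mu = m # replicate (m - 1) 0"
  have "unit_excess mu 1"
    using m by (auto simp: mu unit_excess_def top_sum_def facet_index_def take_Cons' sum_list_replicate
        nth_Cons')
  then show ?thesis using m mu by auto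
next
  assume mu: "mu = 2 # replicate (m - 2) 1 @ [0]"
  \<comment> \<open>For \<open>0 < k < m\<close> the first \<open>k\<close> parts always sum to
    \<open>k + 1\<close>.\<close>
  have "unit_excess mu 1"
    using m by (auto simp: mu unit_excess_def top_sum_def take_Cons' sum_list_replicate)
  then show ?thesis using mu by auto
next
  assume "even m" and mu: "mu = replicate (m div 2) 2 @ replicate (m div 2) 0"
  then obtain a where a: "m = 2 * a" by blast
  \<comment> \<open>The only facet indices are \<open>1\<close> and \<open>m - 1\<close>; the same
    holds for the odd shape below.\<close>
  have "unit_excess mu 1"
    using m by (auto simp: mu a unit_excess_def top_sum_def sum_list_replicate facet_index_def nth_append
        min_def split: if_splits)
  then show ?thesis using m a mu by (auto simp: nth_append)
next
  assume "odd m" and mu: "mu = replicate ((m - 1) div 2) 2 @ [1] @ replicate ((m - 1) div 2) 0"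
  then obtain a where a: "m = 2 * a + 1" by (elim oddE)
  have "unit_excess mu 1"
    using m by (auto simp: mu a unit_excess_def top_sum_def sum_list_replicate facet_index_def nth_append
        take_Cons' nth_Cons' min_def split: if_splits)
  then show ?thesis using m a mu by (auto simp: nth_append)
next
  assume mu: "mu = replicate (m - 1) m @ [0]"
  have "unit_excess mu (int m - 1)"
    unfolding unit_excess_def
  proof (intro conjI allI impI)
    show "int (top_sum mu (length mu)) = int (length mu) * (int m - 1)"
      using m by (simp add: mu top_sum_def sum_list_replicate of_nat_diff)
  next
    fix k assume k: "0 < k \<and> k < length mu \<and> facet_index mu k"
    then have "k < m" using m by (simp add: mu)
    then have "k - 1 < m - 1" "0 < m - 1" using m k by linarith+
    \<comment> \<open>For \<open>k > 1\<close> the first \<open>k\<close> parts all equal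
      \<open>m\<close>, against the first condition of \<open>facet_index\<close>.\<close>
    then have "k = 1"
      using k by (auto simp: facet_index_def mu nth_append)
    then show "int (top_sum mu k) = int k * (int m - 1) + 1"
      using m by (simp add: mu top_sum_def sum_list_replicate)
  qed
  then show ?thesis using m mu by (auto simp: nth_append)
qed

theorem theorem4p6:
  fixes m n :: nat and lam lam' :: "nat list"
  assumes "m = CARD('m::{finite,linorder})"
    and "m \<ge> 2"
    and "is_partition_of lam n"
    and "length lam = m"
    and "lam' = reduction_by_translation lam"
  shows "reflexive (Newt (schur_polynomial lam :: ('m \<Rightarrow>\<^sub>0 nat) \<Rightarrow>\<^sub>0 int)) \<longleftrightarrow>
      lam' = m # replicate (m - 1) 0
    \<or> lam' = 2 # replicate (m - 2) 1 @ [0]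
    \<or> (even m \<and> lam' = replicate (m div 2) 2 @ replicate (m div 2) 0)
    \<or> (odd m \<and> lam' = replicate ((m - 1) div 2) 2 @ [1] @ replicate ((m - 1) div 2) 0)
    \<or> lam' = replicate (m - 1) m @ [0]"
    (is "_ \<longleftrightarrow> ?shape")
proof -
  have dec: "sorted_wrt (\<ge>) lam"
    using assms(3) by (simp add: is_partition_of_def)
  have idx: "m - 1 < m" "0 < m" and ne: "lam \<noteq> []"
    using assms(2,4) by auto
  have last: "last lam = lam ! (m - 1)"
    using last_conv_nth[OF ne] assms(4) by simp
  have last_le: "last lam \<le> x" if x: "x \<in> set lam" for x
  proof -
    obtain i where i: "i < m" "x = lam ! i"
      using x assms(4) by (metis in_set_conv_nth)
    have "i \<le> m - 1" "m - 1 < length lam" using i(1) assms(4) by linarith+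
    then have "lam ! (m - 1) \<le> lam ! i"
      by (rule nth_decreasing[OF dec])
    then show ?thesis by (simp only: last i)
  qed
  \<comment> \<open>The last part is the least, so no subtraction truncates and \<open>lam\<close>
    is recovered from \<open>lam'\<close>.\<close>
  then have lam: "lam = map (\<lambda>k. k + last lam) lam'"
    by (simp add: assms(5) reduction_by_translation_def map_idI)
  have len': "length lam' = m"
    using assms(4,5) by (simp add: reduction_by_translation_def)
  have dec': "sorted_wrt (\<ge>) lam'"
    unfolding assms(5) reduction_by_translation_def sorted_wrt_map
    using dec by (rule sorted_wrt_mono_rel[rotated]) auto
  have last': "lam' ! (m - 1) = 0"
    using idx assms(4) last by (simp add: assms(5) reduction_by_translation_def)
  have first': "lam ! (m - 1) < lam ! 0 \<longleftrightarrow> 0 < lam' ! 0"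
    using idx assms(4) last by (simp add: assms(5) reduction_by_translation_def)
  have "reflexive (Newt (schur_polynomial lam :: ('m \<Rightarrow>\<^sub>0 nat) \<Rightarrow>\<^sub>0 int)) \<longleftrightarrow>
      lam ! (m - 1) < lam ! 0 \<and> (\<exists>c. unit_excess lam c)"
    using reflexive_Newt_schur_polynomial_iff[of lam, where 'm = 'm] dec assms(1,4)
    by (simp add: unit_excess_def)
  also have "(\<exists>c. unit_excess lam c) \<longleftrightarrow> (\<exists>c. unit_excess lam' c)"
  proof -
    have "unit_excess lam c \<longleftrightarrow> unit_excess lam' (c - int (last lam))" for c
      by (subst (1) lam) (rule unit_excess_translate)
    then show ?thesis by (metis add_diff_cancel_right')
  qed
  also have "lam ! (m - 1) < lam ! 0 \<and> (\<exists>c. unit_excess lam' c) \<longleftrightarrow> ?shape"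
    unfolding first'
    using unit_excess_imp_shape[of lam'] unit_excess_of_shape[OF assms(2), of lam']
      assms(2) len' dec' last' by blast
  finally show ?thesis .
qed

end
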